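(* There is a polynomial time algorithm that, given a $P_4$-free graph $G$ together with an edge weight function $w$ on $E(G)$, determines a maximum weight acyclic matching in $G$, that is, an acyclic matching $M$ in $G$ maximizing $\sum_{e\in M}w(e)$ over all acyclic matchings in $G$.
   Context: All graphs are finite, simple, and undirected. A matching in a graph $G$ is a set of pairwise disjoint edges of $G$ (possibly empty). For a matching $M$ in $G$, let $V(M)$ be the set of vertices of $G$ incident with an edge in $M$, and let $G(M)$ be the subgraph of $G$ induced by $V(M)$. The matching $M$ is acyclic if $G(M)$ is a forest. $P_4$ is the path on four vertices, and a graph is $P_4$-free if it has no induced subgraph isomorphic to $P_4$. Edge weights are rational numbers (given by their binary encoding), and polynomial time is measured in the encoding length of $(G,w)$. *)

theory Defs
  imports Complex_Main "HOL-Library.Log_Nat" "HOL-Computational_Algebra.Polynomial"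
begin

section \<open>Graphs and acyclic matchings\<close>

type_synonym 'a ugraph = "'a set \<times> 'a set set"

abbreviation verts :: "'a ugraph \<Rightarrow> 'a set" where "verts \<equiv> fst"
abbreviation edges :: "'a ugraph \<Rightarrow> 'a set set" where "edges \<equiv> snd"

definition simple_graph :: "'a ugraph \<Rightarrow> bool" where
  "simple_graph G \<longleftrightarrow> finite (verts G) \<and> (\<forall>e\<in>edges G. e \<subseteq> verts G \<and> card e = 2)"

definition induced_subgraph :: "'a ugraph \<Rightarrow> 'a set \<Rightarrow> 'a ugraph" where
  "induced_subgraph G S = (S, {e \<in> edges G. e \<subseteq> S})"

definition isomorphic :: "'a ugraph \<Rightarrow> 'b ugraph \<Rightarrow> bool" where
  "isomorphic G H \<longleftrightarrow>
    (\<exists>f. bij_betw f (verts G) (verts H) \<and> (\<lambda>e. f ` e) ` edges G = edges H)"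

definition P4 :: "nat ugraph" where
  "P4 = ({0, 1, 2, 3}, {{0, 1}, {1, 2}, {2, 3}})"

definition P4_free :: "'a ugraph \<Rightarrow> bool" where
  "P4_free G \<longleftrightarrow> \<not> (\<exists>S \<subseteq> verts G. isomorphic (induced_subgraph G S) P4)"

definition is_cycle :: "'a ugraph \<Rightarrow> 'a list \<Rightarrow> bool" where
  "is_cycle G p \<longleftrightarrow> length p \<ge> 3 \<and> distinct p \<and>
    (\<forall>i < length p. {p ! i, p ! (Suc i mod length p)} \<in> edges G)"

definition forest :: "'a ugraph \<Rightarrow> bool" where
  "forest G \<longleftrightarrow> \<not> (\<exists>p. is_cycle G p)"

definition matching :: "'a ugraph \<Rightarrow> 'a set set \<Rightarrow> bool" where
  "matching G M \<longleftrightarrow> M \<subseteq> edges G \<and> (\<forall>e\<in>M. \<forall>f\<in>M. e \<noteq> f \<longrightarrow> e \<inter> f = {})"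

definition acyclic_matching :: "'a ugraph \<Rightarrow> 'a set set \<Rightarrow> bool" where
  "acyclic_matching G M \<longleftrightarrow> matching G M \<and> forest (induced_subgraph G (\<Union>M))"

definition max_weight_acyclic_matching :: "'a ugraph \<Rightarrow> ('a set \<Rightarrow> rat) \<Rightarrow> 'a set set \<Rightarrow> bool" where
  "max_weight_acyclic_matching G w M \<longleftrightarrow> acyclic_matching G M \<and>
    (\<forall>M'. acyclic_matching G M' \<longrightarrow> (\<Sum>e\<in>M'. w e) \<le> (\<Sum>e\<in>M. w e))"


section \<open>Random access machine programs with logarithmic cost\<close>

text \<open>Algorithms are structured programs for a random access machine on integers. The store
  consists of named integer arrays, all of whose cells are zero unless they hold input; a program
  mentions only finitely many of them. Time is measured by the logarithmic cost criterion: every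
  operation is charged the binary lengths of its operands and every memory access the binary
  lengths of the address and of the cell contents. Up to polynomials this is Turing machine time.\<close>

type_synonym vname = string
type_synonym state = "vname \<Rightarrow> int \<Rightarrow> int"

datatype aexp =
    Const int
  | Cell vname aexp  \<comment> \<open>contents of the cell of an array at a computed address\<close>
  | Add aexp aexp
  | Sub aexp aexp
  | Mul aexp aexp

datatype bexp = Less aexp aexp | BNot bexp | BAnd bexp bexp

datatype com =
    Skip
  | Assign vname aexp aexp  \<comment> \<open>array, address, new contents\<close>
  | Seq com com
  | If bexp com com
  | While bexp com

fun aval :: "aexp \<Rightarrow> state \<Rightarrow> int" where
  "aval (Const k) s = k"
| "aval (Cell x a) s = s x (aval a s)"
| "aval (Add a b) s = aval a s + aval b s"
| "aval (Sub a b) s = aval a s - aval b s"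
| "aval (Mul a b) s = aval a s * aval b s"

fun bval :: "bexp \<Rightarrow> state \<Rightarrow> bool" where
  "bval (Less a b) s \<longleftrightarrow> aval a s < aval b s"
| "bval (BNot b) s \<longleftrightarrow> \<not> bval b s"
| "bval (BAnd b c) s \<longleftrightarrow> bval b s \<and> bval c s"

text \<open>The length of the binary representation of an integer, including one symbol for the sign
  (so the integer zero has length one).\<close>

definition len :: "int \<Rightarrow> nat" where
  "len k = Suc (floorlog 2 (nat \<bar>k\<bar>))"

fun acost :: "aexp \<Rightarrow> state \<Rightarrow> nat" where
  "acost (Const k) s = len k"
| "acost (Cell x a) s = acost a s + len (aval a s) + len (s x (aval a s))"
| "acost (Add a b) s = acost a s + acost b s + len (aval a s) + len (aval b s)"
| "acost (Sub a b) s = acost a s + acost b s + len (aval a s) + len (aval b s)"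
| "acost (Mul a b) s = acost a s + acost b s + len (aval a s) + len (aval b s)"

fun bcost :: "bexp \<Rightarrow> state \<Rightarrow> nat" where
  "bcost (Less a b) s = acost a s + acost b s + len (aval a s) + len (aval b s)"
| "bcost (BNot b) s = Suc (bcost b s)"
| "bcost (BAnd b c) s = Suc (bcost b s + bcost c s)"

text \<open>\<open>exec c s t s'\<close>: started in store \<open>s\<close>, the program \<open>c\<close> terminates with store \<open>s'\<close> after
  time \<open>t\<close>.\<close>

inductive exec :: "com \<Rightarrow> state \<Rightarrow> nat \<Rightarrow> state \<Rightarrow> bool" where
  exec_Skip: "exec Skip s 1 s"
| exec_Assign:
    "exec (Assign x a e) s
      (acost a s + acost e s + len (aval a s) + len (aval e s))
      (s(x := (s x)(aval a s := aval e s)))"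
| exec_Seq: "exec c s t1 s1 \<Longrightarrow> exec d s1 t2 s2 \<Longrightarrow> exec (Seq c d) s (t1 + t2) s2"
| exec_IfTrue: "bval b s \<Longrightarrow> exec c s t s' \<Longrightarrow> exec (If b c d) s (bcost b s + t) s'"
| exec_IfFalse: "\<not> bval b s \<Longrightarrow> exec d s t s' \<Longrightarrow> exec (If b c d) s (bcost b s + t) s'"
| exec_WhileFalse: "\<not> bval b s \<Longrightarrow> exec (While b c) s (bcost b s) s"
| exec_WhileTrue: "bval b s \<Longrightarrow> exec c s t1 s1 \<Longrightarrow> exec (While b c) s1 t2 s2 \<Longrightarrow>
    exec (While b c) s (bcost b s + t1 + t2) s2"

inductive_cases exec_SkipE: "exec Skip s t s'"
inductive_cases exec_AssignE: "exec (Assign x a e) s t s'"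
inductive_cases exec_SeqE: "exec (Seq c d) s t s'"
inductive_cases exec_IfE: "exec (If b c d) s t s'"
inductive_cases exec_WhileE: "exec (While b c) s t s'"

lemma exec_deterministic:
  "exec c s t s' \<Longrightarrow> exec c s u s'' \<Longrightarrow> u = t \<and> s'' = s'"
proof (induction arbitrary: u s'' rule: exec.induct)
  case (exec_Skip s)
  then show ?case by (auto elim: exec_SkipE)
next
  case (exec_Assign x a e s)
  then show ?case by (auto elim: exec_AssignE)
next
  case (exec_Seq c s t1 s1 d t2 s2)
  from exec_Seq.prems show ?case
    by (rule exec_SeqE) (use exec_Seq.IH in blast)
next
  case (exec_IfTrue b s c t s' d)
  from exec_IfTrue.prems show ?case
    by (rule exec_IfE) (use exec_IfTrue in blast)+
next
  case (exec_IfFalse b s d t s' c)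
  from exec_IfFalse.prems show ?case
    by (rule exec_IfE) (use exec_IfFalse in blast)+
next
  case (exec_WhileFalse b s c)
  from exec_WhileFalse.prems show ?case
    by (rule exec_WhileE) (use exec_WhileFalse in blast)+
next
  case (exec_WhileTrue b s c t1 s1 t2 s2)
  from exec_WhileTrue.prems show ?case
    by (rule exec_WhileE) (use exec_WhileTrue in blast)+
qed

definition initial_state :: "int list \<Rightarrow> state" where
  "initial_state xs = (\<lambda>x i.
    if x = ''input'' \<and> 0 \<le> i \<and> i < int (length xs) then xs ! nat i else 0)"

definition has_output :: "state \<Rightarrow> int list \<Rightarrow> bool" where
  "has_output s ys \<longleftrightarrow> (\<forall>i < length ys. s ''output'' (int i) = ys ! i)"


section \<open>Encodings\<close>

definition lists_edges :: "nat set set \<Rightarrow> (nat \<times> nat) list \<Rightarrow> bool" where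
  "lists_edges F es \<longleftrightarrow>
    distinct (map (\<lambda>(u, v). {u, v}) es) \<and> set (map (\<lambda>(u, v). {u, v}) es) = F"

text \<open>A weighted graph is encoded by the number of vertices and their names, followed by the number
  of edges and, for every edge, its two ends and the numerator and denominator of its weight in
  lowest terms. A graph has one such encoding for each order in which its vertices, its edges and the
  ends of its edges may be listed.\<close>

definition encodes_weighted_graph :: "nat ugraph \<Rightarrow> (nat set \<Rightarrow> rat) \<Rightarrow> int list \<Rightarrow> bool" where
  "encodes_weighted_graph G w xs \<longleftrightarrow>
    (\<exists>vs es. distinct vs \<and> set vs = verts G \<and> lists_edges (edges G) es \<and>
      xs = int (length vs) # map int vs @ int (length es) #
        concat (map (\<lambda>(u, v). [int u, int v,
          fst (quotient_of (w {u, v})), snd (quotient_of (w {u, v}))]) es))"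

definition encodes_edge_set :: "nat set set \<Rightarrow> int list \<Rightarrow> bool" where
  "encodes_edge_set M ys \<longleftrightarrow>
    (\<exists>es. lists_edges M es \<and>
      ys = int (length es) # concat (map (\<lambda>(u, v). [int u, int v]) es))"

definition encoding_length :: "int list \<Rightarrow> nat" where
  "encoding_length xs = (\<Sum>x\<leftarrow>xs. len x)"

lemma ex_lists_edges:
  assumes "finite F" "\<And>e. e \<in> F \<Longrightarrow> card e = 2"
  shows "\<exists>es. lists_edges F es"
  using assms
proof (induction F rule: finite_induct)
  case empty
  then show ?case by (auto simp: lists_edges_def intro: exI[of _ "[]"])
next
  case (insert e F)
  obtain es where es: "lists_edges F es" using insert by auto
  obtain u v where "e = {u, v}" using insert.prems[of e] by (auto simp: card_2_iff)
  with es insert.hyps have "lists_edges (insert e F) ((u, v) # es)"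
    by (auto simp: lists_edges_def)
  then show ?case ..
qed

lemma ex_encoding:
  assumes "simple_graph G"
  shows "\<exists>xs. encodes_weighted_graph G w xs"
proof -
  have fin: "finite (verts G)" and E: "\<And>e. e \<in> edges G \<Longrightarrow> e \<subseteq> verts G \<and> card e = 2"
    using assms by (auto simp: simple_graph_def)
  then have "finite (edges G)"
    by (meson finite_Pow_iff finite_subset PowI subsetI)
  with E obtain es where "lists_edges (edges G) es" using ex_lists_edges by blast
  moreover obtain vs where "distinct vs" "set vs = verts G"
    using finite_distinct_list[OF fin] by auto
  ultimately show ?thesis unfolding encodes_weighted_graph_def by blast
qed

end

theory Submission
  imports Defs
begin

text \<open>In a \<open>P4\<close>-free graph an acyclic matching is the same as an induced one: an edge between two
  matched edges would give a path on four vertices, which has a chord and hence yields a cycle. So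
  the task is to find an independent set of maximum weight in the conflict graph, whose vertices are
  the edges of \<open>G\<close>, two of them being in conflict if some edge of \<open>G\<close> meets both. Every set of at least
  two vertices of a \<open>P4\<close>-free graph splits into two parts with either all or no edges between them
  (Seinsche), and this carries over to the conflict graph. Hence every set of at least two edges
  contains twins, that is, two edges in conflict with the same other edges of the set. Of two
  conflicting twins only the heavier one matters, and two twins without conflict may be chosen together,
  so that they can be merged, adding their weights. Merging twins until one edge is left solves the
  problem.

  For the running time, it suffices that all loops are bounded by numbers in the input and that
  assignments multiply only by input cells: then both the number of steps and the number of bits added
  in every step are polynomially bounded.\<close>

section \<open>Programs with bounded loops\<close>

text \<open>Joining two twins without conflict turns every choice of one of them into the choice of
  both, which is harmless only for positive weights; therefore edges of nonpositive weight are
  discarded at the start. The machine cannot divide, so each rational weight is replaced by an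
  integer, its numerator times the denominators of all other edges. This long product is the reason
  to allow multiplication inside loops at all, and the danger in it: squaring a cell in every round
  would double its length each time, whereas a factor from the input adds no more than its own
  length.

  Twins are needed in every set of surviving edges, while conflicts are still witnessed by arbitrary
  edges of \<open>G\<close>, also by discarded ones. The splits are therefore derived from the set
  of ends of the surviving edges, with all edges that \<open>G\<close> has between them. The
  existence of twins only guarantees that a search succeeds: the program tries all pairs again and
  again and never builds a decomposition tree, so that plain counting loops suffice.\<close>

datatype prog =
    Nop
  | Put vname aexp aexp
  | Then prog prog (infixr ";;" 60)
  | Cond bexp prog prog
  | For vname aexp prog

definition store :: "vname \<Rightarrow> int \<Rightarrow> int \<Rightarrow> state \<Rightarrow> state" where
  "store x i v s = s(x := (s x)(i := v))"

lemma store_apply: "store x i v s y = (if y = x then (s x)(i := v) else s y)"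
  by (simp add: store_def)

abbreviation Var :: "vname \<Rightarrow> aexp" where
  "Var x \<equiv> Cell x (Const 0)"

primrec compile :: "prog \<Rightarrow> com" where
  "compile Nop = Skip"
| "compile (Put x a e) = Assign x a e"
| "compile (p ;; q) = Seq (compile p) (compile q)"
| "compile (Cond b p q) = If b (compile p) (compile q)"
| "compile (For x b p) = Seq (Assign x (Const 0) (Const 0))
    (While (Less (Var x) b) (Seq (compile p) (Assign x (Const 0) (Add (Var x) (Const 1)))))"

text \<open>A loop evaluates its bound once, on entry, and sets its counter outright, whereas the
  compiled \<open>While\<close> evaluates the bound before every round and increments the counter.
  For \<open>admissible\<close> programs the two agree, since no loop body can change the bound or
  the counter.\<close>

primrec run :: "prog \<Rightarrow> state \<Rightarrow> state" where
  "run Nop s = s"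
| "run (Put x a e) s = store x (aval a s) (aval e s) s"
| "run (p ;; q) s = run q (run p s)"
| "run (Cond b p q) s = (if bval b s then run p s else run q s)"
| "run (For x b p) s = fold (\<lambda>k s. store x 0 (int (Suc k)) (run p s))
    [0..<nat (aval b s)] (store x 0 0 s)"

primrec written :: "prog \<Rightarrow> vname set" where
  "written Nop = {}"
| "written (Put x a e) = {x}"
| "written (p ;; q) = written p \<union> written q"
| "written (Cond b p q) = written p \<union> written q"
| "written (For x b p) = insert x (written p)"

lemma run_frame: "y \<notin> written p \<Longrightarrow> run p s y = s y"
proof (induction p arbitrary: s)
  case (For x b p)
  have "fold (\<lambda>k s. store x 0 (int (Suc k)) (run p s)) ks s y = s y" for ks s
    using For by (induction ks arbitrary: s) (auto simp: store_apply)
  with For.prems show ?case by (simp add: store_apply)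
qed (auto simp: store_apply)

text \<open>Loop bounds depend on the input only, so that they can be evaluated in the initial state.\<close>

primrec input_only :: "aexp \<Rightarrow> bool" where
  "input_only (Const k) \<longleftrightarrow> True"
| "input_only (Cell x a) \<longleftrightarrow> x = ''input'' \<and> input_only a"
| "input_only (Add a b) \<longleftrightarrow> input_only a \<and> input_only b"
| "input_only (Sub a b) \<longleftrightarrow> input_only a \<and> input_only b"
| "input_only (Mul a b) \<longleftrightarrow> input_only a \<and> input_only b"

lemma aval_input_only:
  "input_only a \<Longrightarrow> s ''input'' = s' ''input'' \<Longrightarrow> aval a s = aval a s'"
  by (induction a) auto

text \<open>Linear in the cells outside the input: such an assignment lengthens the longest cell contents
  by at most a constant number of input lengths.\<close>

primrec linear :: "aexp \<Rightarrow> bool" where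
  "linear (Const k) \<longleftrightarrow> True"
| "linear (Cell x a) \<longleftrightarrow> True"
| "linear (Add a b) \<longleftrightarrow> linear a \<and> linear b"
| "linear (Sub a b) \<longleftrightarrow> linear a \<and> linear b"
| "linear (Mul a b) \<longleftrightarrow> linear a \<and> (\<exists>c. b = Cell ''input'' c)"

primrec admissible :: "prog \<Rightarrow> bool" where
  "admissible Nop \<longleftrightarrow> True"
| "admissible (Put x a e) \<longleftrightarrow> x \<noteq> ''input'' \<and> linear e"
| "admissible (p ;; q) \<longleftrightarrow> admissible p \<and> admissible q"
| "admissible (Cond b p q) \<longleftrightarrow> admissible p \<and> admissible q"
| "admissible (For x b p) \<longleftrightarrow> x \<noteq> ''input'' \<and> x \<notin> written p \<and> input_only b \<and> admissible p"

lemma input_not_written: "admissible p \<Longrightarrow> ''input'' \<notin> written p"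
  by (induction p) auto

primrec loops_bounded :: "nat \<Rightarrow> prog \<Rightarrow> state \<Rightarrow> bool" where
  "loops_bounded N Nop s \<longleftrightarrow> True"
| "loops_bounded N (Put x a e) s \<longleftrightarrow> True"
| "loops_bounded N (p ;; q) s \<longleftrightarrow> loops_bounded N p s \<and> loops_bounded N q s"
| "loops_bounded N (Cond b p q) s \<longleftrightarrow> loops_bounded N p s \<and> loops_bounded N q s"
| "loops_bounded N (For x b p) s \<longleftrightarrow> aval b s \<le> int N \<and> loops_bounded N p s"

text \<open>If the contents of all cells have at most \<open>v\<close> bits, then the factors below bound, in units of
  \<open>Suc v\<close>, the lengths of values and the costs of evaluation.\<close>

primrec size_factor :: "aexp \<Rightarrow> nat" where
  "size_factor (Const k) = len k"
| "size_factor (Cell x a) = 1"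
| "size_factor (Add a b) = Suc (size_factor a + size_factor b)"
| "size_factor (Sub a b) = Suc (size_factor a + size_factor b)"
| "size_factor (Mul a b) = size_factor a + size_factor b"

primrec acost_factor :: "aexp \<Rightarrow> nat" where
  "acost_factor (Const k) = len k"
| "acost_factor (Cell x a) = acost_factor a + size_factor a + 2"
| "acost_factor (Add a b) = acost_factor a + acost_factor b + size_factor a + size_factor b + 2"
| "acost_factor (Sub a b) = acost_factor a + acost_factor b + size_factor a + size_factor b + 2"
| "acost_factor (Mul a b) = acost_factor a + acost_factor b + size_factor a + size_factor b + 2"

primrec bcost_factor :: "bexp \<Rightarrow> nat" where
  "bcost_factor (Less a b) = acost_factor a + acost_factor b + size_factor a + size_factor b + 2"
| "bcost_factor (BNot b) = Suc (bcost_factor b)"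
| "bcost_factor (BAnd b c) = Suc (bcost_factor b + bcost_factor c)"

text \<open>In contrast to the factors above, this one is additive: a linear assignment lets
  \<open>v\<close> bits grow to \<open>v + growth e * L\<close>, where \<open>L\<close> bounds the
  length of the input cells. A bound multiplying \<open>v\<close> by a constant in each step would
  become exponential in the number of steps.\<close>

primrec growth :: "aexp \<Rightarrow> nat" where
  "growth (Const k) = len k"
| "growth (Cell x a) = 0"
| "growth (Add a b) = Suc (growth a + growth b)"
| "growth (Sub a b) = Suc (growth a + growth b)"
| "growth (Mul a b) = Suc (growth a)"

text \<open>Evaluation cost and growth are added up so that a single number bounds the time of an
  assignment, in units of \<open>Suc v\<close>, and also the bits that it adds, in units of
  \<open>L\<close>.\<close>

definition put_factor :: "aexp \<Rightarrow> aexp \<Rightarrow> nat" where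
  "put_factor a e = acost_factor a + acost_factor e + size_factor a + size_factor e + 2 + growth e"

text \<open>One polynomial serves twice: if \<open>c\<close> is its value at \<open>N\<close>, then
  a run from cells of \<open>v\<close> bits takes time at most \<open>c * Suc (v + c * L)\<close>
  and leaves cells of at most \<open>v + c * L\<close> bits. The variable \<open>[:0, 1:]\<close>
  stands for the number of rounds of a loop; the constant part pays for resetting the counter and
  for the last, failing test.\<close>

primrec cost_poly :: "prog \<Rightarrow> nat poly" where
  "cost_poly Nop = [:1:]"
| "cost_poly (Put x a e) = [:put_factor a e:]"
| "cost_poly (p ;; q) = cost_poly p + cost_poly q"
| "cost_poly (Cond b p q) = [:bcost_factor b:] + cost_poly p + cost_poly q"
| "cost_poly (For x b p) = [:put_factor (Const 0) (Const 0) + bcost_factor (Less (Var x) b):] +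
    [:0, 1:] * (cost_poly p + [:put_factor (Const 0) (Add (Var x) (Const 1)) +
      bcost_factor (Less (Var x) b):])"

section \<open>Bit lengths of cells and running times of compiled programs\<close>

definition cells_below :: "nat \<Rightarrow> state \<Rightarrow> bool" where
  "cells_below v s \<longleftrightarrow> (\<forall>x i. \<bar>s x i\<bar> < 2 ^ v)"

lemma len_le: "\<bar>k\<bar> < 2 ^ n \<Longrightarrow> len k \<le> Suc n"
  by (simp add: len_def floorlog_le_iff nat_less_iff)

lemma abs_less_two_power_len: "\<bar>k\<bar> < 2 ^ len k"
proof -
  have "nat \<bar>k\<bar> < 2 ^ floorlog 2 (nat \<bar>k\<bar>)"
    using floorlog_le_iff[of 2 "nat \<bar>k\<bar>" "floorlog 2 (nat \<bar>k\<bar>)"] by simp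
  also have "\<dots> \<le> 2 ^ len k" by (simp add: len_def)
  finally show ?thesis by (simp add: nat_less_iff)
qed

lemma two_power_add_less:
  fixes x y :: int
  assumes "\<bar>x\<bar> < 2 ^ p" "\<bar>y\<bar> < 2 ^ q" "p < n" "q < n"
  shows "\<bar>x + y\<bar> < 2 ^ n" "\<bar>x - y\<bar> < 2 ^ n"
proof -
  obtain n' where n: "n = Suc n'" using assms by (cases n) auto
  have "(2::int) ^ p \<le> 2 ^ n'" "(2::int) ^ q \<le> 2 ^ n'"
    using assms n by (auto intro!: power_increasing)
  then have "\<bar>x\<bar> < 2 ^ n'" "\<bar>y\<bar> < 2 ^ n'" using assms(1,2) by linarith+
  then show "\<bar>x + y\<bar> < 2 ^ n" "\<bar>x - y\<bar> < 2 ^ n" unfolding n power_Suc by linarith+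
qed

lemma two_power_mult_less:
  fixes x y :: int
  assumes "\<bar>x\<bar> < 2 ^ p" "\<bar>y\<bar> < 2 ^ q"
  shows "\<bar>x * y\<bar> < 2 ^ (p + q)"
  using mult_strict_mono[OF assms] by (simp add: abs_mult power_add)

lemma less_two_power_mono: "(x::int) < 2 ^ p \<Longrightarrow> p \<le> q \<Longrightarrow> x < 2 ^ q"
  by (meson less_le_trans one_le_numeral power_increasing)

lemma cells_below_mono: "cells_below v s \<Longrightarrow> v \<le> u \<Longrightarrow> cells_below u s"
  unfolding cells_below_def using less_two_power_mono by blast

lemma abs_aval_less:
  assumes "cells_below v s"
  shows "\<bar>aval a s\<bar> < 2 ^ (size_factor a * Suc v)"
proof (induction a)
  case (Const k)
  show ?case using less_two_power_mono[OF abs_less_two_power_len] by simp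
next
  case (Cell x a)
  show ?case using assms less_two_power_mono[of _ v "Suc v"] by (simp add: cells_below_def)
next
  case (Add a b)
  show ?case unfolding aval.simps
    by (rule two_power_add_less[OF Add]) (simp_all add: algebra_simps)
next
  case (Sub a b)
  show ?case unfolding aval.simps
    by (rule two_power_add_less[OF Sub]) (simp_all add: algebra_simps)
next
  case (Mul a b)
  show ?case using two_power_mult_less[OF Mul] by (simp add: algebra_simps)
qed

lemma len_aval_le:
  assumes "cells_below v s"
  shows "len (aval a s) \<le> (size_factor a + 1) * Suc v"
  using len_le[OF abs_aval_less[OF assms, of a]] by simp

lemma acost_le:
  assumes "cells_below v s"
  shows "acost a s \<le> acost_factor a * Suc v"
proof (induction a)
  case (Cell x a)
  have "len (s x (aval a s)) \<le> Suc v"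
    using assms len_le by (simp add: cells_below_def)
  with Cell len_aval_le[OF assms, of a] show ?case by (simp add: algebra_simps)
next
  case (Add a b)
  then show ?case using len_aval_le[OF assms, of a] len_aval_le[OF assms, of b]
    by (simp add: algebra_simps)
next
  case (Sub a b)
  then show ?case using len_aval_le[OF assms, of a] len_aval_le[OF assms, of b]
    by (simp add: algebra_simps)
next
  case (Mul a b)
  then show ?case using len_aval_le[OF assms, of a] len_aval_le[OF assms, of b]
    by (simp add: algebra_simps)
qed simp

lemma bcost_le:
  assumes "cells_below v s"
  shows "bcost b s \<le> bcost_factor b * Suc v"
proof (induction b)
  case (Less a b)
  then show ?case using len_aval_le[OF assms, of a] len_aval_le[OF assms, of b]
      acost_le[OF assms, of a] acost_le[OF assms, of b]
    by (simp add: algebra_simps)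
qed (simp_all add: algebra_simps)

text \<open>A sum is at most one bit longer than its longer summand, and \<open>L \<ge> 1\<close>
  pays for this carry; so \<open>v\<close> enters once and not once per summand. In a linear product
  the second factor has at most \<open>L\<close> bits.\<close>

lemma abs_aval_linear_less:
  assumes "cells_below v s" "\<And>i. \<bar>s ''input'' i\<bar> < 2 ^ L" "L \<ge> 1" "linear a"
  shows "\<bar>aval a s\<bar> < 2 ^ (v + growth a * L)"
  using assms(4)
proof (induction a)
  case (Const k)
  have "len k \<le> v + len k * L" using \<open>L \<ge> 1\<close> by (simp add: trans_le_add2)
  then show ?case using less_two_power_mono[OF abs_less_two_power_len] by simp
next
  case (Cell x a)
  then show ?case using assms(1) by (simp add: cells_below_def)
next
  case (Add a b)
  then have *: "\<bar>aval a s\<bar> < 2 ^ (v + growth a * L)" "\<bar>aval b s\<bar> < 2 ^ (v + growth b * L)" by auto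
  show ?case unfolding aval.simps
    by (rule two_power_add_less[OF *]) (use \<open>L \<ge> 1\<close> in \<open>simp_all add: algebra_simps\<close>)
next
  case (Sub a b)
  then have *: "\<bar>aval a s\<bar> < 2 ^ (v + growth a * L)" "\<bar>aval b s\<bar> < 2 ^ (v + growth b * L)" by auto
  show ?case unfolding aval.simps
    by (rule two_power_add_less[OF *]) (use \<open>L \<ge> 1\<close> in \<open>simp_all add: algebra_simps\<close>)
next
  case (Mul a b)
  then obtain c where "b = Cell ''input'' c" by auto
  with Mul have "\<bar>aval a s * aval b s\<bar> < 2 ^ (v + growth a * L + L)"
    by (intro two_power_mult_less) (auto intro: assms(2))
  then show ?case by (simp add: algebra_simps)
qed

lemma exec_Put:
  assumes "cells_below v s" "\<And>i. \<bar>s ''input'' i\<bar> < 2 ^ L" "L \<ge> 1" "linear e"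
  shows "\<exists>t. exec (Assign x a e) s t (store x (aval a s) (aval e s) s) \<and>
    t \<le> put_factor a e * Suc v \<and>
    cells_below (v + put_factor a e * L) (store x (aval a s) (aval e s) s)"
proof -
  have "v + growth e * L \<le> v + put_factor a e * L"
    by (intro add_left_mono mult_right_mono) (auto simp: put_factor_def)
  then have "\<bar>aval e s\<bar> < 2 ^ (v + put_factor a e * L)"
    using abs_aval_linear_less[OF assms] less_two_power_mono by blast
  moreover have "cells_below (v + put_factor a e * L) s"
    using cells_below_mono[OF assms(1)] by simp
  ultimately have "cells_below (v + put_factor a e * L) (store x (aval a s) (aval e s) s)"
    by (simp add: cells_below_def store_apply)
  moreover have "acost a s + acost e s + len (aval a s) + len (aval e s) \<le> put_factor a e * Suc v"
    using acost_le[OF assms(1), of a] acost_le[OF assms(1), of e]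
      len_aval_le[OF assms(1), of a] len_aval_le[OF assms(1), of e]
    by (simp add: put_factor_def algebra_simps)
  ultimately show ?thesis using exec_Assign[of x a e s] unfolding store_def by blast
qed

text \<open>The shape \<open>c * Suc (v + c * L)\<close> of the time bounds is closed under
  sequencing, although the second part starts from cells that the first has lengthened by
  \<open>c * L\<close> bits.\<close>

lemma time_add:
  fixes t u c d v L :: nat
  assumes "t \<le> c * Suc (v + c * L)" "u \<le> d * Suc (v + c * L + d * L)"
  shows "t + u \<le> (c + d) * Suc (v + (c + d) * L)"
proof -
  have "c * Suc (v + c * L) \<le> c * Suc (v + (c + d) * L)" by (simp add: add_mult_distrib)
  with assms show ?thesis by (simp add: algebra_simps)
qed

text \<open>Induction on the number of rounds left, for all \<open>v\<close>, because each round
  starts from longer cells than the one before. \<open>T\<close> charges every round its body and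
  its guard, and the final guard once more.\<close>

lemma exec_While_loop:
  fixes f :: "nat \<Rightarrow> state \<Rightarrow> state"
  assumes "L \<ge> 1"
    and body: "\<And>k v s. k < n \<Longrightarrow> I k s \<Longrightarrow> cells_below v s \<Longrightarrow>
      bval b s \<and> I (Suc k) (f k s) \<and> cells_below (v + cb * L) (f k s) \<and>
      (\<exists>t. exec c s t (f k s) \<and> t \<le> cb * Suc (v + cb * L))"
    and exit: "\<And>s. I n s \<Longrightarrow> \<not> bval b s"
    and "k \<le> n" "I k s" "cells_below v s"
  defines "T \<equiv> (n - k) * (cb + bcost_factor b) + bcost_factor b"
  shows "\<exists>t. exec (While b c) s t (fold f [k..<n] s) \<and> t \<le> T * Suc (v + T * L) \<and>
    cells_below (v + T * L) (fold f [k..<n] s)"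
  using assms(4-6) unfolding T_def
proof (induction "n - k" arbitrary: k s v)
  case 0
  then have [simp]: "k = n" by simp
  have "bcost b s \<le> bcost_factor b * Suc v" using bcost_le 0 by blast
  then have "bcost b s \<le> bcost_factor b * Suc (v + bcost_factor b * L)"
    by (rule order_trans) simp
  moreover have "exec (While b c) s (bcost b s) s" using exec_WhileFalse[OF exit] 0 by simp
  moreover have "cells_below (v + bcost_factor b * L) s"
    using 0 cells_below_mono by simp
  ultimately show ?case by (intro exI[of _ "bcost b s"]) simp
next
  case (Suc d)
  let ?s = "f k s"
  let ?T = "d * (cb + bcost_factor b) + bcost_factor b"
  have k: "k < n" using Suc by simp
  obtain t where t: "bval b s" "I (Suc k) ?s" "cells_below (v + cb * L) ?s"
    "exec c s t ?s" "t \<le> cb * Suc (v + cb * L)"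
    using body[OF k Suc.prems(2,3)] by blast
  have d: "d = n - Suc k" using Suc by simp
  \<comment> \<open>The guard adds no bits; granting it \<open>bcost_factor b * L\<close>
    nevertheless keeps time and growth under the same factor.\<close>
  have below: "cells_below (v + (cb + bcost_factor b) * L) ?s"
    using t(3) by (rule cells_below_mono) (simp add: algebra_simps)
  obtain u where u: "exec (While b c) ?s u (fold f [Suc k..<n] ?s)"
    "u \<le> ?T * Suc (v + (cb + bcost_factor b) * L + ?T * L)"
    "cells_below (v + (cb + bcost_factor b) * L + ?T * L) (fold f [Suc k..<n] ?s)"
    using Suc.hyps(1)[OF d _ t(2) below] k d by auto
  have "bcost b s \<le> bcost_factor b * Suc v" using bcost_le Suc by blast
  then have "bcost b s \<le> bcost_factor b * Suc (v + bcost_factor b * L)"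
    by (rule order_trans) simp
  from time_add[OF this, of t cb]
  have "bcost b s + t \<le> (bcost_factor b + cb) * Suc (v + (bcost_factor b + cb) * L)"
    using t(5) by (simp add: algebra_simps)
  from time_add[OF this, of u ?T] u(2)
  have time: "bcost b s + t + u \<le>
      (bcost_factor b + cb + ?T) * Suc (v + (bcost_factor b + cb + ?T) * L)"
    by (simp add: ac_simps)
  have T: "(n - k) * (cb + bcost_factor b) + bcost_factor b = bcost_factor b + cb + ?T"
    using Suc.hyps(2)[symmetric] by simp
  have fold: "fold f [k..<n] s = fold f [Suc k..<n] ?s"
    using k by (simp add: upt_rec)
  have "v + (cb + bcost_factor b) * L + ?T * L = v + (bcost_factor b + cb + ?T) * L"
    by (simp add: algebra_simps)
  from u(3)[unfolded this]
  have cells: "cells_below (v + (bcost_factor b + cb + ?T) * L) (fold f [Suc k..<n] ?s)" .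
  have exec: "exec (While b c) s (bcost b s + t + u) (fold f [k..<n] s)"
    unfolding fold by (rule exec_WhileTrue[OF t(1,4) u(1)])
  have cells': "cells_below (v + (bcost_factor b + cb + ?T) * L) (fold f [k..<n] s)"
    unfolding fold by (rule cells)
  from exec time cells' show ?case unfolding T by blast
qed

lemma loops_bounded_cong:
  "admissible p \<Longrightarrow> s ''input'' = s' ''input'' \<Longrightarrow> loops_bounded N p s \<Longrightarrow> loops_bounded N p s'"
proof (induction p)
  case (For x b p)
  then show ?case using aval_input_only[of b s s'] by simp
qed auto

lemma time_mono:
  fixes t c d v L :: nat
  assumes "t \<le> c * Suc (v + c * L)" "c \<le> d"
  shows "t \<le> d * Suc (v + d * L)"
  using assms(1) by (rule order_trans)
    (intro mult_le_mono assms(2) Suc_le_mono[THEN iffD2] add_left_mono order_refl)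

text \<open>Time and growth are bounded in one induction, since the time of a later part depends on
  the lengths left behind by an earlier one.\<close>

lemma exec_compile:
  assumes "L \<ge> 1"
  shows "admissible p \<Longrightarrow> cells_below v s \<Longrightarrow> (\<And>i. \<bar>s ''input'' i\<bar> < 2 ^ L) \<Longrightarrow>
    loops_bounded N p s \<Longrightarrow>
    \<exists>t. exec (compile p) s t (run p s) \<and>
    t \<le> poly (cost_poly p) N * Suc (v + poly (cost_poly p) N * L) \<and>
    cells_below (v + poly (cost_poly p) N * L) (run p s)"
proof (induction p arbitrary: s v)
  case Nop
  then show ?case by (auto intro!: exI[of _ 1] exec_Skip intro: cells_below_mono)
next
  case (Put x a e)
  obtain t where t: "exec (Assign x a e) s t (store x (aval a s) (aval e s) s)"
    "t \<le> put_factor a e * Suc v"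
    "cells_below (v + put_factor a e * L) (store x (aval a s) (aval e s) s)"
    using exec_Put[of v s L e x a] Put assms by auto
  have "put_factor a e * Suc v \<le> put_factor a e * Suc (v + put_factor a e * L)" by simp
  with t(2) have "t \<le> put_factor a e * Suc (v + put_factor a e * L)"
    by (meson order_trans)
  with t show ?case by auto
next
  case (Then p q)
  let ?c = "poly (cost_poly p) N" and ?d = "poly (cost_poly q) N"
  have inp: "run p s ''input'' = s ''input''"
    using input_not_written[of p] Then.prems by (intro run_frame) auto
  obtain t where t: "exec (compile p) s t (run p s)" "t \<le> ?c * Suc (v + ?c * L)"
    "cells_below (v + ?c * L) (run p s)"
    using Then.IH(1)[of v s] Then.prems by auto
  have "loops_bounded N q (run p s)"
    using loops_bounded_cong[of q s "run p s"] Then.prems inp by simp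
  then obtain u where u: "exec (compile q) (run p s) u (run q (run p s))"
    "u \<le> ?d * Suc (v + ?c * L + ?d * L)" "cells_below (v + ?c * L + ?d * L) (run q (run p s))"
    using Then.IH(2)[of "v + ?c * L" "run p s"] Then.prems t inp by auto
  show ?case
    using exec_Seq[OF t(1) u(1)] time_add[OF t(2) u(2)] u(3) by (auto simp: algebra_simps)
next
  case (Cond b p q)
  let ?c = "poly (cost_poly p) N" and ?d = "poly (cost_poly q) N"
  let ?r = "if bval b s then p else q"
  let ?e = "poly (cost_poly ?r) N"
  obtain t where t: "exec (compile ?r) s t (run ?r s)" "t \<le> ?e * Suc (v + ?e * L)"
    "cells_below (v + ?e * L) (run ?r s)"
    using Cond.IH(1)[of v s] Cond.IH(2)[of v s] Cond.prems by (cases "bval b s") auto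
  have "bcost b s \<le> bcost_factor b * Suc v" using bcost_le Cond by blast
  then have 1: "bcost b s \<le> bcost_factor b * Suc (v + bcost_factor b * L)"
    by (rule order_trans) simp
  have 2: "t \<le> ?e * Suc (v + bcost_factor b * L + ?e * L)"
    using t(2) by (rule order_trans) simp
  have le: "bcost_factor b + ?e \<le> bcost_factor b + ?c + ?d" by simp
  have "bcost b s + t \<le> (bcost_factor b + ?c + ?d) * Suc (v + (bcost_factor b + ?c + ?d) * L)"
    by (rule time_mono[OF time_add[OF 1 2] le])
  moreover have "exec (compile (Cond b p q)) s (bcost b s + t) (run (Cond b p q) s)"
    using t(1) exec_IfTrue[of b s "compile p" t] exec_IfFalse[of b s "compile q" t]
    by (cases "bval b s") auto
  moreover have "v + ?e * L \<le> v + (bcost_factor b + ?c + ?d) * L"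
    by (intro add_left_mono mult_right_mono) auto
  then have "cells_below (v + (bcost_factor b + ?c + ?d) * L) (run (Cond b p q) s)"
    using cells_below_mono[OF t(3)] by auto
  ultimately show ?case by auto
next
  case (For x b p)
  let ?c = "poly (cost_poly p) N"
  let ?i = "put_factor (Const 0) (Const 0)"
  let ?inc = "put_factor (Const 0) (Add (Var x) (Const 1))"
  let ?g = "Less (Var x) b"
  let ?body = "Seq (compile p) (Assign x (Const 0) (Add (Var x) (Const 1)))"
  define n where "n = nat (aval b s)"
  define f where "f = (\<lambda>k s. store x 0 (int (Suc k)) (run p s))"
  \<comment> \<open>Keeping the input fixed makes the bound \<open>b\<close> evaluate to the same
    number before every round.\<close>
  define I where "I k s' \<longleftrightarrow> s' ''input'' = s ''input'' \<and> s' x 0 = int k" for k :: nat and s' :: state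
  have x: "x \<noteq> ''input''" "x \<notin> written p" "input_only b" "admissible p"
    using For.prems by auto
  obtain t0 where t0: "exec (Assign x (Const 0) (Const 0)) s t0 (store x 0 0 s)"
    "t0 \<le> ?i * Suc v" "cells_below (v + ?i * L) (store x 0 0 s)"
    using exec_Put[of v s L "Const 0" x "Const 0"] For.prems assms by auto
  have b: "aval b s' = aval b s" if "I k s'" for k s'
    using aval_input_only[of b s' s] x that by (auto simp: I_def)
  have "\<exists>t. exec (While ?g ?body) (store x 0 0 s) t (fold f [0..<n] (store x 0 0 s)) \<and>
    t \<le> ((n - 0) * (?c + ?inc + bcost_factor ?g) + bcost_factor ?g) *
      Suc (v + ?i * L + ((n - 0) * (?c + ?inc + bcost_factor ?g) + bcost_factor ?g) * L) \<and>
    cells_below (v + ?i * L + ((n - 0) * (?c + ?inc + bcost_factor ?g) + bcost_factor ?g) * L)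
      (fold f [0..<n] (store x 0 0 s))"
  proof (rule exec_While_loop[where I = I])
    fix k w s'
    assume k: "k < n" and I: "I k s'" and w: "cells_below w s'"
    have inp: "s' ''input'' = s ''input''" using I by (simp add: I_def)
    have inp': "run p s' ''input'' = s ''input''"
      using run_frame[of "''input''" p s'] input_not_written[OF x(4)] inp by simp
    have x': "run p s' x 0 = int k" using run_frame[OF x(2), of s'] I by (simp add: I_def)
    have "loops_bounded N p s'"
      using loops_bounded_cong[of p s s'] For.prems inp x by simp
    then obtain t where t: "exec (compile p) s' t (run p s')" "t \<le> ?c * Suc (w + ?c * L)"
      "cells_below (w + ?c * L) (run p s')"
      using For.IH[of w s'] x w inp For.prems by auto
    have f: "store x (aval (Const 0) (run p s')) (aval (Add (Var x) (Const 1)) (run p s')) (run p s')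
        = f k s'"
      using x' by (simp add: f_def ac_simps)
    obtain u where u: "exec (Assign x (Const 0) (Add (Var x) (Const 1))) (run p s') u (f k s')"
      "u \<le> ?inc * Suc (w + ?c * L)" "cells_below (w + ?c * L + ?inc * L) (f k s')"
      using exec_Put[of "w + ?c * L" "run p s'" L "Add (Var x) (Const 1)" x "Const 0"]
        t(3) inp' For.prems assms unfolding f by auto
    have "u \<le> ?inc * Suc (w + ?c * L + ?inc * L)"
      using u(2) by (rule order_trans) simp
    note time = time_add[OF t(2) this]
    show "bval ?g s' \<and> I (Suc k) (f k s') \<and> cells_below (w + (?c + ?inc) * L) (f k s') \<and>
      (\<exists>t. exec ?body s' t (f k s') \<and> t \<le> (?c + ?inc) * Suc (w + (?c + ?inc) * L))"
    proof (intro conjI exI)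
      show "bval ?g s'" using k I b[OF I] by (auto simp: I_def n_def)
      show "I (Suc k) (f k s')" using x inp' by (auto simp: I_def f_def store_apply)
      show "cells_below (w + (?c + ?inc) * L) (f k s')" using u(3) by (simp add: algebra_simps)
      show "exec ?body s' (t + u) (f k s')" using exec_Seq[OF t(1) u(1)] .
      show "t + u \<le> (?c + ?inc) * Suc (w + (?c + ?inc) * L)" by (rule time)
    qed
  next
    fix s' assume "I n s'"
    with b[OF this] show "\<not> bval ?g s'" by (auto simp: I_def n_def)
  next
    show "I 0 (store x 0 0 s)" using x by (auto simp: I_def store_apply)
  qed (use assms t0 in auto)
  then obtain t where t: "exec (While ?g ?body) (store x 0 0 s) t (fold f [0..<n] (store x 0 0 s))"
    "t \<le> (n * (?c + ?inc + bcost_factor ?g) + bcost_factor ?g) *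
      Suc (v + ?i * L + (n * (?c + ?inc + bcost_factor ?g) + bcost_factor ?g) * L)"
    "cells_below (v + ?i * L + (n * (?c + ?inc + bcost_factor ?g) + bcost_factor ?g) * L)
      (fold f [0..<n] (store x 0 0 s))"
    by auto
  let ?T = "n * (?c + ?inc + bcost_factor ?g) + bcost_factor ?g"
  have "n \<le> N" using For.prems by (auto simp: n_def)
  then have "n * (?c + ?inc + bcost_factor ?g) \<le> N * (?c + ?inc + bcost_factor ?g)"
    by (rule mult_right_mono) simp
  note step = this
  have poly: "poly (cost_poly (For x b p)) N =
      ?i + (N * (?c + ?inc + bcost_factor ?g) + bcost_factor ?g)"
    by (simp add: algebra_simps)
  have le: "?i + ?T \<le> poly (cost_poly (For x b p)) N"
    unfolding poly by (intro add_left_mono add_right_mono step)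
  have "t0 \<le> ?i * Suc (v + ?i * L)" using t0(2) by (rule order_trans) simp
  then have "t0 + t \<le> poly (cost_poly (For x b p)) N * Suc (v + poly (cost_poly (For x b p)) N * L)"
    using time_mono[OF time_add[OF _ t(2)] le] by blast
  moreover have "exec (compile (For x b p)) s (t0 + t) (run (For x b p) s)"
    using exec_Seq[OF t0(1) t(1)] by (simp add: f_def n_def)
  moreover have "v + ?i * L + ?T * L \<le> v + poly (cost_poly (For x b p)) N * L"
    using mult_right_mono[OF le, of L] by (simp add: algebra_simps)
  then have "cells_below (v + poly (cost_poly (For x b p)) N * L) (run (For x b p) s)"
    using cells_below_mono[OF t(3)] by (simp add: f_def n_def)
  ultimately show ?case by blast
qed

lemma abs_less_two_power_encoding_length:
  assumes "x \<in> set xs"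
  shows "\<bar>x\<bar> < 2 ^ encoding_length xs"
proof -
  have "len x \<le> encoding_length xs"
    unfolding encoding_length_def using assms by (intro member_le_sum_list) auto
  then show ?thesis using abs_less_two_power_len less_two_power_mono by blast
qed

lemma length_le_encoding_length: "length xs \<le> encoding_length xs"
  by (induction xs) (auto simp: encoding_length_def len_def)

text \<open>The values stay short because each of the polynomially many steps adds only polynomially many
  bits to the longest cell.\<close>

theorem compile_polynomial:
  assumes "admissible p"
  shows "\<exists>q. \<forall>xs. loops_bounded (encoding_length xs) p (initial_state xs) \<longrightarrow>
    (\<exists>t. exec (compile p) (initial_state xs) t (run p (initial_state xs)) \<and>
      t \<le> poly q (encoding_length xs))"
proof (rule exI, intro allI impI)
  fix xs
  let ?s = "initial_state xs" and ?E = "encoding_length xs"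
  let ?c = "cost_poly p"
  assume lb: "loops_bounded ?E p ?s"
  \<comment> \<open>The successor makes the length bound at least 1, as \<open>exec_compile\<close>
    requires of \<open>L\<close>, even for the empty list.\<close>
  have cell: "\<bar>?s x i\<bar> < 2 ^ Suc ?E" for x i
  proof -
    have "\<bar>?s x i\<bar> < 2 ^ ?E"
    proof (cases "x = ''input'' \<and> 0 \<le> i \<and> i < int (length xs)")
      case True
      then have "?s x i \<in> set xs" by (auto simp: initial_state_def)
      then show ?thesis by (rule abs_less_two_power_encoding_length)
    next
      case False
      then have "?s x i = 0" by (auto simp: initial_state_def)
      then show ?thesis by simp
    qed
    then show ?thesis by (rule less_two_power_mono) simp
  qed
  have "\<exists>t. exec (compile p) ?s t (run p ?s) \<and>
    t \<le> poly ?c ?E * Suc (Suc ?E + poly ?c ?E * Suc ?E) \<and>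
    cells_below (Suc ?E + poly ?c ?E * Suc ?E) (run p ?s)"
    by (rule exec_compile) (use assms lb cell in \<open>auto simp: cells_below_def\<close>)
  \<comment> \<open>\<open>[:1, 1:]\<close> has the value \<open>Suc ?E\<close> at
    \<open>?E\<close>, which is both the initial cell length and the bound \<open>L\<close>
    here.\<close>
  then show "\<exists>t. exec (compile p) ?s t (run p ?s) \<and>
      t \<le> poly (?c * (1 + ([:1, 1:] + ?c * [:1, 1:]))) ?E"
    by (auto simp: algebra_simps)
qed

section \<open>Twins in conflict graphs\<close>

definition indep :: "('a \<Rightarrow> 'a \<Rightarrow> bool) \<Rightarrow> 'a set \<Rightarrow> bool" where
  "indep R I \<longleftrightarrow> (\<forall>i\<in>I. \<forall>j\<in>I. i \<noteq> j \<longrightarrow> \<not> R i j)"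

text \<open>The two operations that build cographs: join and disjoint union.\<close>

definition split_by :: "('a \<Rightarrow> 'a \<Rightarrow> bool) \<Rightarrow> 'a set \<Rightarrow> 'a set \<Rightarrow> 'a set \<Rightarrow> bool" where
  "split_by R A B C \<longleftrightarrow> A = B \<union> C \<and> B \<inter> C = {} \<and> B \<noteq> {} \<and> C \<noteq> {} \<and>
    ((\<forall>b\<in>B. \<forall>c\<in>C. R b c) \<or> (\<forall>b\<in>B. \<forall>c\<in>C. \<not> R b c))"

text \<open>Leaving out \<open>i\<close> and \<open>j\<close> themselves admits adjacent twins as
  well as nonadjacent ones.\<close>

definition twins :: "('a \<Rightarrow> 'a \<Rightarrow> bool) \<Rightarrow> 'a set \<Rightarrow> 'a \<Rightarrow> 'a \<Rightarrow> bool" where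
  "twins R A i j \<longleftrightarrow> i \<in> A \<and> j \<in> A \<and> i \<noteq> j \<and> (\<forall>k\<in>A - {i, j}. R i k \<longleftrightarrow> R j k)"

definition path4 :: "('a \<Rightarrow> 'a \<Rightarrow> bool) \<Rightarrow> 'a \<Rightarrow> 'a \<Rightarrow> 'a \<Rightarrow> 'a \<Rightarrow> bool" where
  "path4 R a b c d \<longleftrightarrow> distinct [a, b, c, d] \<and> R a b \<and> R b c \<and> R c d \<and>
    \<not> R a c \<and> \<not> R b d \<and> \<not> R a d"

text \<open>If \<open>v\<close> has no neighbour in \<open>C\<close>, then \<open>C\<close> still
  splits off. Otherwise take a neighbour \<open>c\<close> there: an edge of \<open>B\<close> from a
  neighbour \<open>b\<close> of \<open>v\<close> to a nonneighbour \<open>b'\<close> would give the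
  induced path \<open>b'\<close>, \<open>b\<close>, \<open>v\<close>, \<open>c\<close>. Hence the
  nonneighbours of \<open>v\<close> in \<open>B\<close> split off, and \<open>u\<close> is one of
  them.\<close>

lemma split_insert_aux:
  assumes sym: "symp R" and free: "\<And>a b c d. {a, b, c, d} \<subseteq> insert v A \<Longrightarrow> \<not> path4 R a b c d"
    and "v \<notin> A" "A = B \<union> C" "B \<inter> C = {}" "B \<noteq> {}" "C \<noteq> {}"
    and no: "\<forall>b\<in>B. \<forall>c\<in>C. \<not> R b c" and u: "u \<in> B" "\<not> R v u"
  shows "\<exists>B C. split_by R (insert v A) B C"
proof -
  have s: "R x y \<longleftrightarrow> R y x" for x y using sym by (auto simp: symp_def)
  show ?thesis
  proof (cases "\<exists>c\<in>C. R v c")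
    case False
    then have "split_by R (insert v A) (insert v B) C"
      using assms by (auto simp: split_by_def)
    then show ?thesis by blast
  next
    case True
    then obtain c where c: "c \<in> C" "R v c" by blast
    have "\<not> R b b'" if "b \<in> B" "R v b" "b' \<in> B" "\<not> R v b'" for b b'
    proof
      assume "R b b'"
      then have "path4 R b' b v c"
        unfolding path4_def using that c no s assms(3-5) by auto
      moreover have "{b', b, v, c} \<subseteq> insert v A" using that c assms(4) by auto
      ultimately show False using free by blast
    qed
    then have "split_by R (insert v A) {b \<in> B. \<not> R v b} (insert v {b \<in> B. R v b} \<union> C)"
      unfolding split_by_def using s no u assms(3-5) by auto
    then show ?thesis by blast
  qed
qed

lemma split_by_compl: "split_by (\<lambda>x y. \<not> R x y) A B C \<longleftrightarrow> split_by R A B C"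
  by (auto simp: split_by_def)

text \<open>The path on four vertices is self-complementary, which reduces the splitting of joins to
  that of disjoint unions.\<close>

lemma path4_compl: "path4 (\<lambda>x y. \<not> R x y) a b c d \<Longrightarrow> symp R \<Longrightarrow> path4 R b d a c"
  unfolding path4_def symp_def by auto

text \<open>A nonneighbour of \<open>v\<close> lies in one of the two parts, whose roles can be
  exchanged; if there is none, \<open>v\<close> is joined to all the rest.\<close>

lemma split_insert_nonadjacent:
  assumes sym: "symp R" and free: "\<And>a b c d. {a, b, c, d} \<subseteq> insert v A \<Longrightarrow> \<not> path4 R a b c d"
    and "v \<notin> A" "A = B \<union> C" "B \<inter> C = {}" "B \<noteq> {}" "C \<noteq> {}"
    and no: "\<forall>b\<in>B. \<forall>c\<in>C. \<not> R b c"
  shows "\<exists>B C. split_by R (insert v A) B C"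
proof -
  have s: "R x y \<longleftrightarrow> R y x" for x y using sym by (auto simp: symp_def)
  consider u where "u \<in> B" "\<not> R v u" | u where "u \<in> C" "\<not> R v u" | "\<forall>u\<in>A. R v u"
    using assms(4) by blast
  then show ?thesis
  proof cases
    case 1
    then show ?thesis using split_insert_aux[OF assms] by blast
  next
    case 2
    have "\<forall>b\<in>C. \<forall>c\<in>B. \<not> R b c" using no s by blast
    then show ?thesis
      using split_insert_aux[OF sym free assms(3), of C B u] 2 assms(4-7)
      by (simp add: Un_commute Int_commute)
  next
    case 3
    then have "split_by R (insert v A) {v} A"
      unfolding split_by_def using assms(3,4,6) by auto
    then show ?thesis by blast
  qed
qed

text \<open>A split of \<open>A\<close> is carried over to \<open>insert v A\<close>; if it is a
  join, this is done in the complement.\<close>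

lemma P4_free_split:
  assumes "finite A" "card A \<ge> 2" and sym: "symp R"
    and "\<And>a b c d. {a, b, c, d} \<subseteq> A \<Longrightarrow> \<not> path4 R a b c d"
  shows "\<exists>B C. split_by R A B C"
  using assms(1,2,4)
proof (induction A rule: finite_induct)
  case (insert v A)
  show ?case
  proof (cases "card A \<ge> 2")
    case True
    have "\<not> path4 R a b c d" if "{a, b, c, d} \<subseteq> A" for a b c d
      using insert.prems(2) that by (meson subset_insertI2)
    with insert.IH True obtain B C where "split_by R A B C" by meson
    then have BC: "A = B \<union> C" "B \<inter> C = {}" "B \<noteq> {}" "C \<noteq> {}"
      and "(\<forall>b\<in>B. \<forall>c\<in>C. \<not> R b c) \<or> (\<forall>b\<in>B. \<forall>c\<in>C. R b c)"
      by (auto simp: split_by_def)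
    from this(5) show ?thesis
    proof
      assume "\<forall>b\<in>B. \<forall>c\<in>C. \<not> R b c"
      with BC show ?thesis
        using split_insert_nonadjacent[OF sym insert.prems(2) insert.hyps(2)] by blast
    next
      assume *: "\<forall>b\<in>B. \<forall>c\<in>C. R b c"
      have "\<exists>B C. split_by (\<lambda>x y. \<not> R x y) (insert v A) B C"
      proof (rule split_insert_nonadjacent[OF _ _ insert.hyps(2) BC])
        show "symp (\<lambda>x y. \<not> R x y)" using sym by (auto simp: symp_def)
        show "\<not> path4 (\<lambda>x y. \<not> R x y) a b c d" if "{a, b, c, d} \<subseteq> insert v A" for a b c d
          using path4_compl[OF _ sym] insert.prems(2)[of b d a c] that by blast
      qed (use * in auto)
      then show ?thesis by (simp add: split_by_compl)
    qed
  next
    case False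
    with insert obtain u where "A = {u}"
      by (metis One_nat_def Suc_1 card_1_singletonE card_insert_disjoint le_antisym not_less_eq_eq)
    with insert.hyps have "split_by R (insert v A) {v} A"
      by (auto simp: split_by_def)
    then show ?thesis by blast
  qed
qed simp

text \<open>A smallest module with at least two elements has exactly two: otherwise a part of its split
  would be a smaller one.\<close>

lemma ex_twins:
  assumes fin: "finite A" and "card A \<ge> 2" and sym: "symp R"
    and split: "\<And>S. S \<subseteq> A \<Longrightarrow> card S \<ge> 2 \<Longrightarrow> \<exists>B C. split_by R S B C"
  shows "\<exists>i j. twins R A i j"
proof -
  \<comment> \<open>These are the modules of \<open>A\<close> with at least two elements. The whole
    set \<open>A\<close> is one, so a smallest one exists.\<close>
  define Q where "Q S \<longleftrightarrow> S \<subseteq> A \<and> card S \<ge> 2 \<and> (\<forall>x\<in>S. \<forall>y\<in>S. \<forall>z\<in>A - S. R x z \<longleftrightarrow> R y z)" for S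
  have s: "R x y \<longleftrightarrow> R y x" for x y using sym by (auto simp: symp_def)
  have "Q A" using assms by (simp add: Q_def)
  then obtain S where S: "Q S" and min: "\<And>S'. Q S' \<Longrightarrow> card S \<le> card S'"
    using ex_has_least_nat[of Q A card] by blast
  then have "S \<subseteq> A" "card S \<ge> 2" by (auto simp: Q_def)
  then obtain B C where BC: "split_by R S B C" using split by blast
  have finS: "finite S" using S fin by (auto simp: Q_def finite_subset)
  have small: "card X \<le> 1" if "X = B \<or> X = C" for X
  proof (rule ccontr)
    assume "\<not> card X \<le> 1"
    then have "card X \<ge> 2" by simp
    have "X \<subset> S" using BC that unfolding split_by_def by blast
    \<comment> \<open>No \<open>z\<close> tells elements of \<open>X\<close> apart: one in the other
      part does not because of the split, one outside \<open>S\<close> does not because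
      \<open>S\<close> is a module.\<close>
    have "R x z \<longleftrightarrow> R y z" if z: "x \<in> X" "y \<in> X" "z \<in> A - X" for x y z
    proof (cases "z \<in> S")
      case True
      then have "X = B \<and> z \<in> C \<or> X = C \<and> z \<in> B"
        using BC \<open>X = B \<or> X = C\<close> z unfolding split_by_def by blast
      then have "(R x z \<longleftrightarrow> R y z) \<or> (R z x \<longleftrightarrow> R z y)"
        using BC z(1,2) unfolding split_by_def by blast
      then show ?thesis using s by blast
    next
      case False
      then show ?thesis using S z \<open>X \<subset> S\<close> unfolding Q_def by blast
    qed
    then have "Q X"
      using S \<open>card X \<ge> 2\<close> psubset_imp_subset[OF \<open>X \<subset> S\<close>] unfolding Q_def
      by (meson order_trans)
    have "card X < card S" using \<open>X \<subset> S\<close> finS by (rule psubset_card_mono[rotated])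
    with \<open>Q X\<close> show False using min[of X] by simp
  qed
  have "finite B" "finite C" "B \<noteq> {}" "C \<noteq> {}"
    using BC finS by (auto simp: split_by_def)
  then have "card B \<noteq> 0" "card C \<noteq> 0" by auto
  with small[of B] small[of C] have "card B = 1" "card C = 1" by auto
  then obtain i j where "B = {i}" "C = {j}" by (meson card_1_singletonE)
  with BC have "S = {i, j}" "i \<noteq> j" by (auto simp: split_by_def)
  with S have "R i k \<longleftrightarrow> R j k" if "k \<in> A - {i, j}" for k
    using that unfolding Q_def by blast
  then have "twins R A i j"
    using \<open>S = {i, j}\<close> \<open>i \<noteq> j\<close> \<open>S \<subseteq> A\<close> unfolding twins_def by blast
  then show ?thesis by blast
qed

section \<open>Acyclic matchings and conflicts in \<open>P4\<close>-free graphs\<close>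

lemma P4_freeD:
  assumes "simple_graph G" "P4_free G" "{a, b, c, d} \<subseteq> verts G"
  shows "\<not> path4 (\<lambda>u v. {u, v} \<in> edges G) a b c d" (is "\<not> path4 ?R a b c d")
proof
  assume p: "path4 ?R a b c d"
  then have dist: "a \<noteq> b" "a \<noteq> c" "a \<noteq> d" "b \<noteq> c" "b \<noteq> d" "c \<noteq> d" by (auto simp: path4_def)
  define f :: "'a \<Rightarrow> nat" where
    "f x = (if x = a then 0 else if x = b then 1 else if x = c then 2 else 3)" for x
  have f: "f a = 0" "f b = 1" "f c = 2" "f d = 3" using dist by (auto simp: f_def)
  let ?S = "{a, b, c, d}"
  have "{e \<in> edges G. e \<subseteq> ?S} = {{a, b}, {b, c}, {c, d}}" (is "?L = ?E")
  proof
    show "?E \<subseteq> ?L" using p by (auto simp: path4_def)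
    show "?L \<subseteq> ?E"
    proof
      fix e assume e: "e \<in> ?L"
      then have "card e = 2" using \<open>simple_graph G\<close> by (auto simp: simple_graph_def)
      then obtain u v where "e = {u, v}" "u \<noteq> v" by (auto simp: card_2_iff)
      with e p show "e \<in> ?E" by (auto simp: path4_def insert_commute)
    qed
  qed
  moreover have "bij_betw f ?S {0, 1, 2, 3}"
    using f by (auto simp: bij_betw_def inj_on_def)
  ultimately have "isomorphic (induced_subgraph G ?S) P4"
    unfolding isomorphic_def induced_subgraph_def P4_def using f by (intro exI[of _ f]) auto
  with assms show False by (auto simp: P4_free_def)
qed

text \<open>By \<open>non\<close>, the matched vertices induce no edges besides those of
  \<open>M\<close>, but a cycle contains two different edges with a common end.\<close>

lemma acyclic_matchingI:
  assumes "simple_graph G" "M \<subseteq> edges G"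
    and non: "\<And>e f k. e \<in> M \<Longrightarrow> f \<in> M \<Longrightarrow> k \<in> edges G \<Longrightarrow> k \<inter> e \<noteq> {} \<Longrightarrow> k \<inter> f \<noteq> {} \<Longrightarrow> e = f"
  shows "acyclic_matching G M"
proof -
  have c2: "card k = 2" if "k \<in> edges G" for k
    using assms(1) that by (auto simp: simple_graph_def)
  \<comment> \<open>Disjointness is the case \<open>k = e\<close> of \<open>non\<close>.\<close>
  have m: "matching G M"
    unfolding matching_def using assms(2) non by blast
  have in_M: "k \<in> M" if k: "k \<in> edges G" "k \<subseteq> \<Union>M" for k
  proof -
    obtain u v where uv: "k = {u, v}" using c2[OF k(1)] by (auto simp: card_2_iff)
    with k obtain e f where ef: "e \<in> M" "u \<in> e" "f \<in> M" "v \<in> f" by auto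
    with non[of e f k] k uv have "e = f" by auto
    with ef uv have "k \<subseteq> e" by auto
    moreover have "card e = 2" "finite e" using ef assms(2) c2[of e] card.infinite by fastforce+
    ultimately have "k = e" using card_subset_eq[of e k] c2[OF k(1)] by simp
    with ef show ?thesis by simp
  qed
  have "\<not> is_cycle (induced_subgraph G (\<Union>M)) p" for p
  proof
    assume p: "is_cycle (induced_subgraph G (\<Union>M)) p"
    then have l: "length p \<ge> 3" "distinct p" and
      E: "\<And>i. i < length p \<Longrightarrow> {p ! i, p ! (Suc i mod length p)} \<in> M"
      using in_M by (auto simp: is_cycle_def induced_subgraph_def)
    have 0: "{p ! 0, p ! 1} \<in> M" using E[of 0] l by (cases "length p") auto
    have 1: "{p ! 1, p ! 2} \<in> M" using E[of 1] l by (simp add: numeral_2_eq_2)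
    have "{p ! 0, p ! 1} \<inter> {p ! 1, p ! 2} \<noteq> {}" by simp
    with m 0 1 have "{p ! 0, p ! 1} = {p ! 1, p ! 2}"
      unfolding matching_def by meson
    moreover have "p \<noteq> []" using l by auto
    then have "p ! 0 \<noteq> p ! 1" "p ! 0 \<noteq> p ! 2"
      using l nth_eq_iff_index_eq[of p 0 1] nth_eq_iff_index_eq[of p 0 2] by auto
    ultimately show False by (auto simp: doubleton_eq_iff)
  qed
  then show ?thesis using m by (simp add: acyclic_matching_def forest_def)
qed

lemma is_cycle_triangle:
  assumes "distinct [x, y, z]" "{x, y} \<in> edges G" "{y, z} \<in> edges G" "{z, x} \<in> edges G"
  shows "is_cycle G [x, y, z]"
  using assms by (simp add: is_cycle_def All_less_Suc)

lemma is_cycle_quadrangle: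
  assumes "distinct [x, y, z, u]" "{x, y} \<in> edges G" "{y, z} \<in> edges G"
    "{z, u} \<in> edges G" "{u, x} \<in> edges G"
  shows "is_cycle G [x, y, z, u]"
  using assms by (simp add: is_cycle_def All_less_Suc)

text \<open>If \<open>e = {a, b}\<close> and \<open>f = {c, d}\<close> were different and joined by
  \<open>k = {b, c}\<close>, then every chord of the path would close a cycle among matched
  vertices: a triangle through \<open>{a, c}\<close> or \<open>{b, d}\<close>, a quadrangle through
  \<open>{a, d}\<close>. So the path would be induced.\<close>

lemma acyclic_matchingD:
  assumes G: "simple_graph G" "P4_free G" and M: "acyclic_matching G M"
    and ef: "e \<in> M" "f \<in> M" and k: "k \<in> edges G" "k \<inter> e \<noteq> {}" "k \<inter> f \<noteq> {}"
  shows "e = f"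
proof (rule ccontr)
  assume "e \<noteq> f"
  have ME: "M \<subseteq> edges G" and disj: "e \<inter> f = {}"
    using M ef \<open>e \<noteq> f\<close> by (auto simp: acyclic_matching_def matching_def)
  have c2: "card k = 2 \<and> k \<subseteq> verts G" if "k \<in> edges G" for k
    using G(1) that by (auto simp: simple_graph_def)
  obtain b c where bc: "b \<in> k" "b \<in> e" "c \<in> k" "c \<in> f" using k by blast
  with disj have "b \<noteq> c" by auto
  with bc c2[OF k(1)] have kbc: "k = {b, c}" by (auto simp: card_2_iff)
  obtain a where a: "e = {a, b}" "a \<noteq> b"
    using c2[of e] ME ef bc by (auto simp: card_2_iff insert_commute)
  obtain d where d: "f = {c, d}" "c \<noteq> d"
    using c2[of f] ME ef bc by (auto simp: card_2_iff insert_commute)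
  have dist: "distinct [a, b, c, d]" using a d disj by auto
  have E: "{a, b} \<in> edges G" "{b, c} \<in> edges G" "{c, d} \<in> edges G"
    using a d kbc k ef ME by auto
  let ?H = "induced_subgraph G (\<Union>M)"
  have sub: "{a, b, c, d} \<subseteq> \<Union>M" using a d ef by auto
  have nocyc: "\<not> is_cycle ?H p" for p
    using M by (auto simp: acyclic_matching_def forest_def)
  have H: "{x, y} \<in> edges ?H" if "{x, y} \<in> edges G" "{x, y} \<subseteq> {a, b, c, d}" for x y
    using that sub by (auto simp: induced_subgraph_def)
  have "{a, c} \<notin> edges G"
    using nocyc is_cycle_triangle[of a b c ?H] E dist H[of a b] H[of b c] H[of c a]
    by (auto simp: insert_commute)
  moreover have "{b, d} \<notin> edges G"
    using nocyc is_cycle_triangle[of b c d ?H] E dist H[of b c] H[of c d] H[of d b]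
    by (auto simp: insert_commute)
  moreover have "{a, d} \<notin> edges G"
    using nocyc is_cycle_quadrangle[of a b c d ?H] E dist H[of a b] H[of b c] H[of c d] H[of d a]
    by (auto simp: insert_commute)
  ultimately have "path4 (\<lambda>u v. {u, v} \<in> edges G) a b c d"
    using dist E by (simp add: path4_def)
  moreover have "{a, b, c, d} \<subseteq> verts G" using E c2 by blast
  ultimately show False using P4_freeD[OF G] by blast
qed

text \<open>Let the ends of the edges in \<open>A\<close> split into \<open>X\<close> and
  \<open>Y\<close>. In a disjoint union every edge lies within one part, and edges in different
  parts do not conflict. In a join, an edge with an end in each part conflicts with all others and
  splits off alone; without such an edge, all edges within \<open>X\<close> conflict with all those
  within \<open>Y\<close>.\<close>

lemma conflict_split:
  fixes e :: "'b \<Rightarrow> 'a set"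
  assumes G: "simple_graph G" "P4_free G" and inj: "inj_on e I" and E: "e ` I = edges G"
    and A: "A \<subseteq> I" "finite A" "card A \<ge> 2"
  defines "R \<equiv> \<lambda>i j. \<exists>k\<in>I. e k \<inter> e i \<noteq> {} \<and> e k \<inter> e j \<noteq> {}"
  shows "\<exists>B C. split_by R A B C"
proof -
  define S where "S = \<Union>(e ` A)"
  let ?R = "\<lambda>u v. {u, v} \<in> edges G"
  have e2: "card (e i) = 2 \<and> e i \<subseteq> verts G" if "i \<in> I" for i
    using G(1) E that by (auto simp: simple_graph_def)
  have eA: "card (e i) = 2" "e i \<subseteq> verts G" "e i \<subseteq> S" if "i \<in> A" for i
    using e2[of i] A that by (auto simp: S_def)
  have SV: "S \<subseteq> verts G" using eA by (auto simp: S_def)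
  have "finite S" using SV G(1) by (auto simp: simple_graph_def finite_subset)
  obtain i0 where i0: "i0 \<in> A" using A by fastforce
  then have "card S \<ge> 2" using eA[of i0] card_mono[OF \<open>finite S\<close>, of "e i0"] by simp
  have symR: "symp ?R" by (auto simp: symp_def insert_commute)
  obtain X Y where XY: "split_by ?R S X Y"
    using P4_free_split[OF \<open>finite S\<close> \<open>card S \<ge> 2\<close> symR P4_freeD[OF G subset_trans[OF _ SV]]] by blast
  have edge: "?R u v" if i: "i \<in> I" "u \<in> e i" "v \<in> e i" "u \<noteq> v" for i u v
  proof -
    have "finite (e i)" using e2[OF i(1)] card.infinite by fastforce
    then have "{u, v} = e i" using card_subset_eq[of "e i" "{u, v}"] e2[OF i(1)] i by auto
    then show ?thesis using E i by auto
  qed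
  have adj: "R i j" if "u \<in> e i" "v \<in> e j" "?R u v" for i j u v
  proof -
    have "{u, v} \<in> e ` I" using E that(3) by simp
    then obtain k where k: "k \<in> I" "e k = {u, v}" by (elim imageE) simp
    have "e k \<inter> e i \<noteq> {}" "e k \<inter> e j \<noteq> {}" using that k(2) by auto
    with k(1) show ?thesis unfolding R_def by blast
  qed
  have adjD: "\<exists>u\<in>e i. \<exists>v\<in>e j. u = v \<or> ?R u v" if R: "R i j" for i j
  proof -
    obtain k u v where "k \<in> I" "u \<in> e k" "u \<in> e i" "v \<in> e k" "v \<in> e j"
      using R unfolding R_def by blast
    then show ?thesis using edge[of k u v] by blast
  qed
  define B where "B = {i \<in> A. e i \<subseteq> X}"
  define C where "C = {i \<in> A. e i \<subseteq> Y}"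
  have ne: "e i \<noteq> {}" if "i \<in> A" for i using eA[OF that] by auto
  have XY': "S = X \<union> Y" "X \<inter> Y = {}" "X \<noteq> {}" "Y \<noteq> {}" using XY by (auto simp: split_by_def)
  have inA: "\<exists>i\<in>A. x \<in> e i" if "x \<in> X \<union> Y" for x using that XY'(1) by (auto simp: S_def)
  \<comment> \<open>Shared by the two cases in which no edge of \<open>A\<close> crosses between
    \<open>X\<close> and \<open>Y\<close>.\<close>
  have parts: "A = B \<union> C \<and> B \<inter> C = {} \<and> B \<noteq> {} \<and> C \<noteq> {}"
    if mono: "\<And>i. i \<in> A \<Longrightarrow> e i \<subseteq> X \<or> e i \<subseteq> Y"
  proof (intro conjI)
    show "A = B \<union> C" using mono by (auto simp: B_def C_def)
    show "B \<inter> C = {}" using ne XY'(2) by (force simp: B_def C_def)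
    obtain x y where "x \<in> X" "y \<in> Y" using XY' by blast
    with inA obtain i j where "i \<in> A" "x \<in> e i" "j \<in> A" "y \<in> e j" by (meson UnCI)
    then have "i \<in> B" "j \<in> C"
      using mono[of i] mono[of j] \<open>x \<in> X\<close> \<open>y \<in> Y\<close> XY'(2) by (auto simp: B_def C_def)
    then show "B \<noteq> {}" "C \<noteq> {}" by auto
  qed
  show ?thesis
  proof (cases "\<forall>x\<in>X. \<forall>y\<in>Y. \<not> ?R x y")
    case True
    have "e i \<subseteq> X \<or> e i \<subseteq> Y" if "i \<in> A" for i
      using True XY'(1,2) edge[of i] eA(3)[OF that] that A(1) by blast
    then have "A = B \<union> C \<and> B \<inter> C = {} \<and> B \<noteq> {} \<and> C \<noteq> {}" by (rule parts)
    moreover have "\<not> R i j" if "i \<in> B" "j \<in> C" for i j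
    proof
      assume "R i j"
      then obtain u v where "u \<in> e i" "v \<in> e j" "u = v \<or> ?R u v" using adjD by blast
      moreover from this have "u \<in> X" "v \<in> Y" using that by (auto simp: B_def C_def)
      ultimately show False using True XY'(2) by blast
    qed
    ultimately have "split_by R A B C" by (auto simp: split_by_def)
    then show ?thesis by blast
  next
    case False
    then have join: "\<forall>x\<in>X. \<forall>y\<in>Y. ?R x y" using XY by (auto simp: split_by_def)
    show ?thesis
    proof (cases "\<exists>i\<in>A. \<exists>x\<in>e i. \<exists>y\<in>e i. x \<in> X \<and> y \<in> Y")
      case True
      then obtain i x y where i: "i \<in> A" "x \<in> e i" "y \<in> e i" "x \<in> X" "y \<in> Y" by blast
      \<comment> \<open>Whichever part an end \<open>z\<close> of \<open>e j\<close> lies in, the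
        crossing edge \<open>e i\<close> has an end in the other part, adjacent to
        \<open>z\<close>.\<close>
      have "R i j" if j: "j \<in> A" for j
      proof -
        obtain z where z: "z \<in> e j" using ne[OF j] by auto
        with eA(3)[OF j] XY'(1) have "z \<in> X \<or> z \<in> Y" by auto
        then show ?thesis using adj z i join by (metis insert_commute)
      qed
      moreover have "A - {i} \<noteq> {}"
      proof
        assume "A - {i} = {}"
        then have "A = {i}" using i by auto
        then show False using A by simp
      qed
      ultimately have "split_by R A {i} (A - {i})" using i by (auto simp: split_by_def)
      then show ?thesis by blast
    next
      case False
      have "e i \<subseteq> X \<or> e i \<subseteq> Y" if "i \<in> A" for i
        using False XY'(1) eA(3)[OF that] that by blast
      then have "A = B \<union> C \<and> B \<inter> C = {} \<and> B \<noteq> {} \<and> C \<noteq> {}" by (rule parts)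
      moreover have "R i j" if ij: "i \<in> B" "j \<in> C" for i j
      proof -
        obtain x y where "x \<in> e i" "y \<in> e j" using ij ne[of i] ne[of j] unfolding B_def C_def by blast
        then show ?thesis using adj[of x i y j] join ij unfolding B_def C_def by blast
      qed
      ultimately have "split_by R A B C" by (auto simp: split_by_def)
      then show ?thesis by blast
    qed
  qed
qed

section \<open>Merging twins\<close>

text \<open>Surviving indices, their weights, and for every index the one that stands for it.\<close>

type_synonym merging = "nat set \<times> (nat \<Rightarrow> int) \<times> (nat \<Rightarrow> nat)"

text \<open>When the lighter of two conflicting twins is dropped, \<open>g\<close> stays as it is:
  indices that point to a removed one are thereby excluded from the solution.\<close>

fun merge :: "(nat \<Rightarrow> nat \<Rightarrow> bool) \<Rightarrow> nat \<Rightarrow> nat \<Rightarrow> merging \<Rightarrow> merging" where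
  "merge R i j (A, W, g) =
    (if \<not> twins R A i j then (A, W, g)
     else if \<not> R i j then (A - {j}, W(i := W i + W j), \<lambda>k. if g k = j then i else g k)
     else if W i < W j then (A - {i}, W, g)
     else (A - {j}, W, g))"

text \<open>Independent sets of survivors expand along \<open>g\<close> to independent sets of
  original indices of equal weight, and no original independent set is heavier than all of those.
  Positivity is part of the invariant because joining twins and the final choice of all survivors
  rely on it.\<close>

definition represents :: "(nat \<Rightarrow> nat \<Rightarrow> bool) \<Rightarrow> nat \<Rightarrow> (nat \<Rightarrow> int) \<Rightarrow> merging \<Rightarrow> bool" where
  "represents R m w = (\<lambda>(A, W, g). A \<subseteq> {..<m} \<and> (\<forall>k<m. g k < m) \<and> (\<forall>i\<in>A. 0 < W i) \<and>
    (\<forall>I\<subseteq>A. indep R I \<longrightarrow>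
      indep R {k. k < m \<and> g k \<in> I} \<and> sum w {k. k < m \<and> g k \<in> I} = sum W I) \<and>
    (\<forall>J\<subseteq>{..<m}. indep R J \<longrightarrow> (\<exists>I\<subseteq>A. indep R I \<and> sum w J \<le> sum W I)))"

lemma representsI:
  assumes "A \<subseteq> {..<m}" "\<And>k. k < m \<Longrightarrow> g k < m" "\<And>i. i \<in> A \<Longrightarrow> 0 < W i"
    and "\<And>I. I \<subseteq> A \<Longrightarrow> indep R I \<Longrightarrow>
      indep R {k. k < m \<and> g k \<in> I} \<and> sum w {k. k < m \<and> g k \<in> I} = sum W I"
    and "\<And>J. J \<subseteq> {..<m} \<Longrightarrow> indep R J \<Longrightarrow> \<exists>I\<subseteq>A. indep R I \<and> sum w J \<le> sum W I"
  shows "represents R m w (A, W, g)"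
  unfolding represents_def prod.case using assms by (intro conjI allI impI ballI) auto

lemma indep_subset: "indep R I \<Longrightarrow> J \<subseteq> I \<Longrightarrow> indep R J"
  unfolding indep_def by blast

lemma indep_insert:
  assumes "symp R" "indep R I" "\<And>k. k \<in> I \<Longrightarrow> k \<noteq> x \<Longrightarrow> \<not> R x k"
  shows "indep R (insert x I)"
  using assms by (auto simp: indep_def dest: sympD)

lemma indepD: "indep R I \<Longrightarrow> i \<in> I \<Longrightarrow> j \<in> I \<Longrightarrow> i \<noteq> j \<Longrightarrow> \<not> R i j"
  by (simp add: indep_def)

text \<open>Removing the indices of nonpositive weight from \<open>J\<close> keeps it independent
  and does not lower its weight.\<close>

lemma represents_positive:
  "represents R m w ({k. k < m \<and> 0 < w k}, w, \<lambda>k. k)"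
proof -
  have "\<exists>I\<subseteq>{k. k < m \<and> 0 < w k}. indep R I \<and> sum w J \<le> sum w I"
    if J: "J \<subseteq> {..<m}" "indep R J" for J
  proof (intro exI conjI)
    let ?I = "{k \<in> J. 0 < w k}"
    have "finite J" using J(1) by (rule finite_subset) simp
    then have "sum w J = sum w ?I + sum w (J - ?I)"
      by (metis (no_types, lifting) mem_Collect_eq subsetI sum.subset_diff add.commute)
    moreover have "sum w (J - ?I) \<le> 0" by (rule sum_nonpos) auto
    ultimately show "sum w J \<le> sum w ?I" by simp
    show "?I \<subseteq> {k. k < m \<and> 0 < w k}" using J(1) by auto
    show "indep R ?I" using J(2) by (rule indep_subset) auto
  qed
  moreover have "{k. k < m \<and> k \<in> I} = I" if "I \<subseteq> {k. k < m \<and> 0 < w k}" for I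
    using that by auto
  ultimately show ?thesis by (auto simp: represents_def)
qed

text \<open>An exchange argument: an independent set containing \<open>j\<close> cannot contain
  \<open>i\<close>, and replacing \<open>j\<close> by its twin \<open>i\<close> creates no conflict
  and loses no weight.\<close>

lemma represents_drop:
  assumes rep: "represents R m w (A, W, g)" and tw: "twins R A i j" and sym: "symp R"
    and R: "R i j" and le: "W j \<le> W i"
  shows "represents R m w (A - {j}, W, g)"
proof -
  have r: "A \<subseteq> {..<m}" "\<forall>k<m. g k < m" "\<forall>i\<in>A. 0 < W i"
    "\<And>I. I \<subseteq> A \<Longrightarrow> indep R I \<Longrightarrow>
      indep R {k. k < m \<and> g k \<in> I} \<and> sum w {k. k < m \<and> g k \<in> I} = sum W I"
    "\<And>J. J \<subseteq> {..<m} \<Longrightarrow> indep R J \<Longrightarrow> \<exists>I\<subseteq>A. indep R I \<and> sum w J \<le> sum W I"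
    using rep by (auto simp: represents_def)
  have finA: "finite A" using r(1) by (rule finite_subset) simp
  have ij: "i \<in> A" "j \<in> A" "i \<noteq> j" "\<And>k. k \<in> A - {i, j} \<Longrightarrow> R i k \<longleftrightarrow> R j k"
    using tw by (auto simp: twins_def)
  have "\<exists>I\<subseteq>A - {j}. indep R I \<and> sum w J \<le> sum W I" if J: "J \<subseteq> {..<m}" "indep R J" for J
  proof -
    obtain I where I: "I \<subseteq> A" "indep R I" "sum w J \<le> sum W I" using r(5)[OF J] by blast
    show ?thesis
    proof (cases "j \<in> I")
      case False
      with I show ?thesis by blast
    next
      case True
      have "i \<notin> I" using indepD[OF I(2) _ True ij(3)] R by auto
      have ni: "\<not> R i k" if k: "k \<in> I - {j}" for k
      proof -
        have "k \<in> A - {i, j}" using k I(1) \<open>i \<notin> I\<close> by auto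
        then show ?thesis using ij(4)[of k] indepD[OF I(2) True, of k] k by auto
      qed
      have "indep R (insert i (I - {j}))"
        using ni indep_subset[OF I(2)] by (intro indep_insert[OF sym]) auto
      moreover have "insert i (I - {j}) \<subseteq> A - {j}" using I(1) ij by auto
      moreover have "sum W (insert i (I - {j})) = sum W I - W j + W i"
        using \<open>i \<notin> I\<close> True finite_subset[OF I(1) finA] by (simp add: sum_diff1)
      then have "sum w J \<le> sum W (insert i (I - {j}))" using I(3) le by simp
      ultimately show ?thesis by blast
    qed
  qed
  moreover have "indep R {k. k < m \<and> g k \<in> I} \<and> sum w {k. k < m \<and> g k \<in> I} = sum W I"
    if "I \<subseteq> A - {j}" "indep R I" for I
    using that by (intro r(4)) auto
  ultimately show ?thesis using r(1-3) by (intro representsI) auto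
qed

text \<open>An independent set containing one of two twins without conflict remains independent when
  the other is added, and gains weight since \<open>W\<close> is positive. So it suffices to
  consider sets with both or neither of them, and \<open>i\<close> can stand for both.\<close>

lemma represents_join:
  assumes rep: "represents R m w (A, W, g)" and tw: "twins R A i j" and sym: "symp R"
    and R: "\<not> R i j"
  shows "represents R m w (A - {j}, W(i := W i + W j), \<lambda>k. if g k = j then i else g k)"
proof -
  have s: "R x y \<longleftrightarrow> R y x" for x y using sym by (auto simp: symp_def)
  have r: "A \<subseteq> {..<m}" "\<forall>k<m. g k < m" "\<forall>i\<in>A. 0 < W i"
    "\<And>I. I \<subseteq> A \<Longrightarrow> indep R I \<Longrightarrow>
      indep R {k. k < m \<and> g k \<in> I} \<and> sum w {k. k < m \<and> g k \<in> I} = sum W I"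
    "\<And>J. J \<subseteq> {..<m} \<Longrightarrow> indep R J \<Longrightarrow> \<exists>I\<subseteq>A. indep R I \<and> sum w J \<le> sum W I"
    using rep by (auto simp: represents_def)
  have finA: "finite A" using r(1) by (rule finite_subset) simp
  have ij: "i \<in> A" "j \<in> A" "i \<noteq> j" "\<And>k. k \<in> A - {i, j} \<Longrightarrow> R i k \<longleftrightarrow> R j k"
    using tw by (auto simp: twins_def)
  let ?W = "W(i := W i + W j)" and ?g = "\<lambda>k. if g k = j then i else g k"
  have sumW: "sum ?W I = sum W (insert j I)" if "I \<subseteq> A - {j}" "i \<in> I" for I
  proof -
    have fin: "finite I" using that finA by (meson Diff_subset finite_subset)
    have "sum ?W I = ?W i + sum ?W (I - {i})" using that fin by (simp add: sum.remove)
    also have "sum ?W (I - {i}) = sum W (I - {i})" by (rule sum.cong) auto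
    also have "?W i + sum W (I - {i}) = W j + (W i + sum W (I - {i}))" by simp
    also have "W i + sum W (I - {i}) = sum W I" using that fin by (simp add: sum.remove)
    also have "W j + sum W I = sum W (insert j I)" using that fin by (subst sum.insert) auto
    finally show ?thesis .
  qed
  have sumW': "sum ?W I = sum W I" if "i \<notin> I" for I
    using that by (intro sum.cong) auto
  have ext: "indep R (insert y I)"
    if I: "indep R I" "I \<subseteq> A" "x \<in> I" and xy: "x = i \<and> y = j \<or> x = j \<and> y = i" for I x y
  proof -
    have "\<not> R y k" if k: "k \<in> I" "k \<noteq> y" for k
    proof (cases "k = x")
      case True
      then show ?thesis using R s[of i j] xy by auto
    next
      case False
      then have "k \<in> A - {i, j}" using k I(2) xy by auto
      then have "R x k \<longleftrightarrow> R y k" using ij(4)[of k] xy by auto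
      moreover have "\<not> R x k" using indepD[OF I(1,3) k(1)] False by simp
      ultimately show ?thesis by simp
    qed
    then show ?thesis using I(1) by (intro indep_insert[OF sym])
  qed
  have part1: "indep R {k. k < m \<and> ?g k \<in> I} \<and> sum w {k. k < m \<and> ?g k \<in> I} = sum ?W I"
    if I: "I \<subseteq> A - {j}" "indep R I" for I
  proof (cases "i \<in> I")
    case True
    \<comment> \<open>After the redirection, a set \<open>I\<close> containing \<open>i\<close>
      expands to what \<open>insert j I\<close> stood for before.\<close>
    have "{k. k < m \<and> ?g k \<in> I} = {k. k < m \<and> g k \<in> insert j I}" using True by auto
    moreover have "insert j I \<subseteq> A" using I ij by auto
    moreover have "indep R (insert j I)" using ext[of I i j] I True by blast
    ultimately show ?thesis using r(4)[of "insert j I"] sumW[OF I(1) True] by (simp only:)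
  next
    case False
    then have "{k. k < m \<and> ?g k \<in> I} = {k. k < m \<and> g k \<in> I}" using I by auto
    then show ?thesis using r(4)[of I] sumW'[OF False] I by auto
  qed
  have part2: "\<exists>I\<subseteq>A - {j}. indep R I \<and> sum w J \<le> sum ?W I" if J: "J \<subseteq> {..<m}" "indep R J" for J
  proof -
    obtain I where I: "I \<subseteq> A" "indep R I" "sum w J \<le> sum W I" using r(5)[OF J] by blast
    show ?thesis
    proof (cases "i \<in> I \<or> j \<in> I")
      case False
      then have "sum w J \<le> sum ?W I" using I(3) sumW'[of I] by simp
      moreover have "I \<subseteq> A - {j}" using False I(1) by auto
      ultimately show ?thesis using I(2) by blast
    next
      case True
      let ?K = "insert j (insert i I)"
      have K: "indep R ?K"
        using True ext[OF I(2,1), of i j] ext[OF I(2,1), of j i]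
        by (auto simp: insert_commute insert_absorb)
      have fin: "finite ?K" using I(1) finA by (simp add: finite_subset)
      have "sum W I \<le> sum W ?K"
        using fin r(3) ij by (intro sum_mono2) (auto intro: less_imp_le)
      also have "?K = insert j (insert i I - {j})" by auto
      also have "sum W \<dots> = sum ?W (insert i I - {j})"
        using I(1) ij by (intro sumW[symmetric]) auto
      finally have "sum w J \<le> sum ?W (insert i I - {j})" using I(3) by simp
      moreover have "indep R (insert i I - {j})" using K by (rule indep_subset) auto
      moreover have "insert i I - {j} \<subseteq> A - {j}" using I(1) ij by auto
      ultimately show ?thesis by blast
    qed
  qed
  show ?thesis
    by (rule representsI[OF _ _ _ part1 part2]) (use r(1-3) ij in \<open>auto simp: add_pos_pos\<close>)
qed

lemma twins_commute: "twins R A i j \<longleftrightarrow> twins R A j i"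
  unfolding twins_def by (auto simp: insert_commute)

lemma represents_merge:
  assumes "represents R m w \<sigma>" and sym: "symp R"
  shows "represents R m w (merge R i j \<sigma>)"
proof (cases \<sigma>)
  case (fields A W g)
  have "represents R m w (A - {i}, W, g)" if "twins R A i j" "R i j" "W i < W j"
    using represents_drop[of R m w A W g j i] that assms fields sympD[OF sym]
    by (simp add: twins_commute)
  moreover have "represents R m w (A - {j}, W, g)" if "twins R A i j" "R i j" "\<not> W i < W j"
    using represents_drop[of R m w A W g i j] that assms fields by simp
  moreover have "represents R m w (A - {j}, W(i := W i + W j), \<lambda>k. if g k = j then i else g k)"
    if "twins R A i j" "\<not> R i j"
    using represents_join[of R m w A W g i j] that assms fields by simp
  ultimately show ?thesis using assms(1) fields by simp
qed

lemma merge_no_twins: "\<not> twins R (fst \<sigma>) i j \<Longrightarrow> merge R i j \<sigma> = \<sigma>"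
  by (cases \<sigma>) simp

lemma card_merge:
  assumes "finite (fst \<sigma>)"
  shows "card (fst (merge R i j \<sigma>)) \<le> card (fst \<sigma>)"
    "twins R (fst \<sigma>) i j \<Longrightarrow> card (fst (merge R i j \<sigma>)) < card (fst \<sigma>)"
proof -
  obtain A W g where \<sigma>: "\<sigma> = (A, W, g)" by (cases \<sigma>)
  have *: "card (A - {x}) < card A" if "x \<in> A" for x
    using card_Diff1_less[of A x] assms that \<sigma> by simp
  then show lt: "twins R (fst \<sigma>) i j \<Longrightarrow> card (fst (merge R i j \<sigma>)) < card (fst \<sigma>)"
    by (auto simp: \<sigma> twins_def)
  show "card (fst (merge R i j \<sigma>)) \<le> card (fst \<sigma>)"
    by (cases "twins R (fst \<sigma>) i j") (use lt in \<open>auto simp: merge_no_twins\<close>)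
qed

text \<open>As long as no pair has been merged, all pairs in \<open>D\<close> were tested against the same set \<open>A0\<close>;
  hence a sweep over all pairs merges at least once, unless at most one index is left.\<close>

definition progress :: "(nat \<Rightarrow> nat \<Rightarrow> bool) \<Rightarrow> nat set \<Rightarrow> (nat \<times> nat) set \<Rightarrow> nat set \<Rightarrow> bool" where
  "progress R A0 D A \<longleftrightarrow> card A < card A0 \<or> A = A0 \<and> (\<forall>(i, j)\<in>D. \<not> twins R A0 i j)"

lemma progress_merge:
  assumes "progress R A0 D (fst \<sigma>)" "finite (fst \<sigma>)"
  shows "progress R A0 (insert (i, j) D) (fst (merge R i j \<sigma>))"
proof (cases "twins R (fst \<sigma>) i j")
  case True
  from card_merge(2)[OF assms(2) this] assms(1) show ?thesis by (auto simp: progress_def)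
next
  case False
  then show ?thesis using assms(1) by (auto simp: progress_def merge_no_twins)
qed

text \<open>A set of at most one survivor is independent, and by positivity it outweighs its
  subsets. It is empty if no weight is positive.\<close>

lemma represents_optimal:
  assumes "represents R m w (A, W, g)" "card A \<le> 1" "J \<subseteq> {..<m}" "indep R J"
  shows "indep R {k. k < m \<and> g k \<in> A}" "sum w J \<le> sum w {k. k < m \<and> g k \<in> A}"
proof -
  have r: "A \<subseteq> {..<m}" "\<forall>i\<in>A. 0 < W i"
    "\<And>I. I \<subseteq> A \<Longrightarrow> indep R I \<Longrightarrow>
      indep R {k. k < m \<and> g k \<in> I} \<and> sum w {k. k < m \<and> g k \<in> I} = sum W I"
    "\<And>J. J \<subseteq> {..<m} \<Longrightarrow> indep R J \<Longrightarrow> \<exists>I\<subseteq>A. indep R I \<and> sum w J \<le> sum W I"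
    using assms(1) by (auto simp: represents_def)
  have finA: "finite A" using r(1) by (rule finite_subset) simp
  have "indep R A" using assms(2) finA by (auto simp: indep_def card_le_Suc0_iff_eq)
  note A = r(3)[OF order_refl this]
  then show "indep R {k. k < m \<and> g k \<in> A}" by simp
  obtain I where I: "I \<subseteq> A" "sum w J \<le> sum W I" using r(4) assms by blast
  have "sum W I \<le> sum W A" using I(1) finA r(2) by (intro sum_mono2) (auto intro: less_imp_le)
  with A I show "sum w J \<le> sum w {k. k < m \<and> g k \<in> A}" by simp
qed

section \<open>The program\<close>

text \<open>The rule supplies the counter and the frame condition in each round, so that an
  invariant \<open>P\<close> has to mention only what the body changes.\<close>

lemma run_For:
  assumes "x \<notin> written p" "aval b s = int n" "P 0 (store x 0 0 s)"
    and step: "\<And>k s'. k < n \<Longrightarrow> s' x 0 = int k \<Longrightarrow> (\<And>y. y \<notin> insert x (written p) \<Longrightarrow> s' y = s y) \<Longrightarrow>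
      P k s' \<Longrightarrow> P (Suc k) (store x 0 (int (Suc k)) (run p s'))"
  shows "P n (run (For x b p) s)"
proof -
  let ?f = "\<lambda>k s. store x 0 (int (Suc k)) (run p s)"
  have "P k (fold ?f [0..<k] (store x 0 0 s)) \<and> fold ?f [0..<k] (store x 0 0 s) x 0 = int k \<and>
    (\<forall>y. y \<notin> insert x (written p) \<longrightarrow> fold ?f [0..<k] (store x 0 0 s) y = s y)" if "k \<le> n" for k
    using that
  proof (induction k)
    case 0
    have "P 0 (fold ?f [0..<0] (store x 0 0 s))" using assms(3) by simp
    moreover have "fold ?f [0..<0] (store x 0 0 s) x 0 = int 0" by (simp add: store_apply)
    moreover have "fold ?f [0..<0] (store x 0 0 s) y = s y" if "y \<notin> insert x (written p)" for y
      using that by (simp add: store_apply)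
    ultimately show ?case by blast
  next
    case (Suc k)
    let ?s = "fold ?f [0..<k] (store x 0 0 s)"
    have IH: "P k ?s" "?s x 0 = int k" "\<And>y. y \<notin> insert x (written p) \<Longrightarrow> ?s y = s y"
      using Suc by auto
    have "P (Suc k) (?f k ?s)" by (rule step) (use IH Suc.prems in auto)
    moreover have "?f k ?s y = s y" if "y \<notin> insert x (written p)" for y
      using IH(3)[OF that] that run_frame[of y p ?s] by (auto simp: store_apply)
    moreover have "?f k ?s x 0 = int (Suc k)" by (simp add: store_apply)
    moreover have "fold ?f [0..<Suc k] (store x 0 0 s) = ?f k ?s" by simp
    ultimately show ?case by (simp only:) blast
  qed
  then show ?thesis using assms(2) by simp
qed

abbreviation beq :: "aexp \<Rightarrow> aexp \<Rightarrow> bexp" where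
  "beq a b \<equiv> BAnd (BNot (Less a b)) (BNot (Less b a))"

abbreviation bor :: "bexp \<Rightarrow> bexp \<Rightarrow> bexp" where
  "bor b c \<equiv> BNot (BAnd (BNot b) (BNot c))"

text \<open>Input cell 0 holds the number of vertices; their names come next, and then the number of
  edges.\<close>

definition edge_number :: aexp where
  "edge_number = Cell ''input'' (Add (Const 1) (Cell ''input'' (Const 0)))"

text \<open>With offset 2, 3, 4, 5: the two ends of an edge and the numerator and denominator of its
  weight.\<close>

definition field :: "int \<Rightarrow> aexp \<Rightarrow> aexp" where
  "field r a = Cell ''input'' (Add (Add (Cell ''input'' (Const 0)) (Const r)) (Mul (Const 4) a))"

definition meets :: "aexp \<Rightarrow> aexp \<Rightarrow> bexp" where
  "meets a b = bor (bor (beq (field 2 a) (field 2 b)) (beq (field 2 a) (field 3 b)))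
    (bor (beq (field 3 a) (field 2 b)) (beq (field 3 a) (field 3 b)))"

text \<open>Row-major address of an entry of the conflict matrix, which has as many rows and columns
  as there are edges.\<close>

definition entry :: "aexp \<Rightarrow> aexp \<Rightarrow> aexp" where
  "entry a b = Add (Mul a edge_number) b"

text \<open>The denominator is the second operand of \<open>Mul\<close>, where \<open>linear\<close>
  demands an input cell.\<close>

definition scale_prog :: prog where
  "scale_prog = For ''j'' edge_number (Cond (beq (Var ''i'') (Var ''j'')) Nop
    (Put ''w'' (Var ''i'') (Mul (Cell ''w'' (Var ''i'')) (field 5 (Var ''j'')))))"

text \<open>The arrays \<open>''w''\<close>, \<open>''a''\<close> and \<open>''g''\<close> hold the
  three parts of a \<open>merging\<close>: scaled weights, flags of the surviving indices, and
  representatives.\<close>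

definition weight_prog :: prog where
  "weight_prog = For ''i'' edge_number
    (Put ''w'' (Var ''i'') (field 4 (Var ''i'')) ;; scale_prog ;;
     Cond (Less (Const 0) (Cell ''w'' (Var ''i''))) (Put ''a'' (Var ''i'') (Const 1)) Nop ;;
     Put ''g'' (Var ''i'') (Var ''i''))"

definition conflict_prog3 :: prog where
  "conflict_prog3 = For ''k'' edge_number
    (Cond (BAnd (meets (Var ''k'') (Var ''i'')) (meets (Var ''k'') (Var ''j'')))
      (Put ''c'' (entry (Var ''i'') (Var ''j'')) (Const 1)) Nop)"

definition conflict_prog2 :: prog where
  "conflict_prog2 = For ''j'' edge_number conflict_prog3"

definition conflict_prog :: prog where
  "conflict_prog = For ''i'' edge_number conflict_prog2"

text \<open>Tests only the comparison with third indices; the remaining conditions of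
  \<open>twins\<close> are left to \<open>merge_prog\<close>.\<close>

definition twins_prog :: prog where
  "twins_prog = Put ''t'' (Const 0) (Const 1) ;;
    For ''k'' edge_number
      (Cond (BAnd (BAnd (beq (Cell ''a'' (Var ''k'')) (Const 1))
          (BAnd (BNot (beq (Var ''k'') (Var ''i''))) (BNot (beq (Var ''k'') (Var ''j'')))))
          (BNot (beq (Cell ''c'' (entry (Var ''i'') (Var ''k'')))
            (Cell ''c'' (entry (Var ''j'') (Var ''k''))))))
        (Put ''t'' (Const 0) (Const 0)) Nop)"

definition redirect_prog :: prog where
  "redirect_prog = For ''k'' edge_number (Cond (beq (Cell ''g'' (Var ''k'')) (Var ''j''))
    (Put ''g'' (Var ''k'') (Var ''i'')) Nop)"

definition merge_prog :: prog where
  "merge_prog = twins_prog ;;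
    Cond (BAnd (BAnd (beq (Var ''t'') (Const 1)) (BNot (beq (Var ''i'') (Var ''j''))))
        (BAnd (beq (Cell ''a'' (Var ''i'')) (Const 1)) (beq (Cell ''a'' (Var ''j'')) (Const 1))))
      (Cond (beq (Cell ''c'' (entry (Var ''i'') (Var ''j''))) (Const 1))
        (Cond (Less (Cell ''w'' (Var ''i'')) (Cell ''w'' (Var ''j'')))
          (Put ''a'' (Var ''i'') (Const 0))
          (Put ''a'' (Var ''j'') (Const 0)))
        (Put ''w'' (Var ''i'') (Add (Cell ''w'' (Var ''i'')) (Cell ''w'' (Var ''j''))) ;;
         Put ''a'' (Var ''j'') (Const 0) ;; redirect_prog))
      Nop"

definition sweep_prog1 :: prog where
  "sweep_prog1 = For ''j'' edge_number merge_prog"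

definition sweep_prog :: prog where
  "sweep_prog = For ''i'' edge_number sweep_prog1"

text \<open>As many sweeps as edges are enough, since each sweep removes an index as long as two
  survive.\<close>

definition rounds_prog :: prog where
  "rounds_prog = For ''r'' edge_number sweep_prog"

text \<open>An edge is selected if its representative survives. The counter \<open>''q''\<close>
  relies on cells outside the input being zero at the start.\<close>

definition output_prog :: prog where
  "output_prog = For ''i'' edge_number
    (Cond (beq (Cell ''a'' (Cell ''g'' (Var ''i''))) (Const 1))
      (Put ''output'' (Add (Const 1) (Mul (Const 2) (Var ''q''))) (field 2 (Var ''i'')) ;;
       Put ''output'' (Add (Const 2) (Mul (Const 2) (Var ''q''))) (field 3 (Var ''i'')) ;;
       Put ''q'' (Const 0) (Add (Var ''q'') (Const 1)))
      Nop) ;;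
    Put ''output'' (Const 0) (Var ''q'')"

definition matching_prog :: prog where
  "matching_prog = weight_prog ;; conflict_prog ;; rounds_prog ;; output_prog"

section \<open>What the program computes from its input array\<close>

lemmas prog_defs = matching_prog_def output_prog_def rounds_prog_def sweep_prog_def sweep_prog1_def
  merge_prog_def redirect_prog_def twins_prog_def conflict_prog_def conflict_prog2_def
  conflict_prog3_def weight_prog_def scale_prog_def

lemma admissible_matching_prog: "admissible matching_prog"
  by (simp add: prog_defs edge_number_def field_def)

lemma loops_bounded_matching_prog:
  "aval edge_number s \<le> int N \<Longrightarrow> loops_bounded N matching_prog s"
  by (simp add: prog_defs)

lemma written_simps:
  "written scale_prog = {''j'', ''w''}"
  "written conflict_prog3 = {''k'', ''c''}"
  "written conflict_prog2 = {''j'', ''k'', ''c''}"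
  "written twins_prog = {''t'', ''k''}"
  "written redirect_prog = {''k'', ''g''}"
  "written merge_prog = {''t'', ''k'', ''a'', ''w'', ''g''}"
  "written sweep_prog1 = {''j'', ''t'', ''k'', ''a'', ''w'', ''g''}"
  "written sweep_prog = {''i'', ''j'', ''t'', ''k'', ''a'', ''w'', ''g''}"
  "written weight_prog = {''i'', ''w'', ''j'', ''a'', ''g''}"
  "written conflict_prog = {''i'', ''j'', ''k'', ''c''}"
  "written rounds_prog = {''r'', ''i'', ''j'', ''t'', ''k'', ''a'', ''w'', ''g''}"
  by (auto simp: prog_defs)

locale edge_data =
  fixes inp :: "int \<Rightarrow> int" and m :: nat
  assumes edge_number: "inp (1 + inp 0) = int m"
begin

definition fld :: "int \<Rightarrow> nat \<Rightarrow> int" where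
  "fld r i = inp (inp 0 + r + 4 * int i)"

definition meet :: "nat \<Rightarrow> nat \<Rightarrow> bool" where
  "meet i j \<longleftrightarrow> {fld 2 i, fld 3 i} \<inter> {fld 2 j, fld 3 j} \<noteq> {}"

text \<open>Taking \<open>k\<close> to be \<open>i\<close> itself covers the case that \<open>i\<close> and \<open>j\<close> share an end.\<close>

definition conf :: "nat \<Rightarrow> nat \<Rightarrow> bool" where
  "conf i j \<longleftrightarrow> (\<exists>k<m. meet k i \<and> meet k j)"

text \<open>The rational weights, scaled by the product of all denominators.\<close>

definition weight :: "nat \<Rightarrow> int" where
  "weight i = fld 4 i * (\<Prod>j\<in>{..<m} - {i}. fld 5 j)"

lemma symp_conf: "symp conf"
  by (auto simp: symp_def conf_def)

lemma aval_edge_number: "s ''input'' = inp \<Longrightarrow> aval edge_number s = int m"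
  using edge_number by (simp add: edge_number_def)

lemma aval_field: "s ''input'' = inp \<Longrightarrow> aval a s = int k \<Longrightarrow> aval (field r a) s = fld r k"
  by (simp add: field_def fld_def)

lemma bval_meets:
  "s ''input'' = inp \<Longrightarrow> aval a s = int k \<Longrightarrow> aval b s = int l \<Longrightarrow> bval (meets a b) s \<longleftrightarrow> meet k l"
  by (auto simp: meets_def meet_def aval_field)

lemma aval_entry:
  "s ''input'' = inp \<Longrightarrow> aval a s = int i \<Longrightarrow> aval b s = int j \<Longrightarrow>
    aval (entry a b) s = int (i * m + j)"
  by (simp add: entry_def aval_edge_number)

lemma entry_eq_iff:
  assumes "j < m" "j' < m"
  shows "i * m + j = i' * m + j' \<longleftrightarrow> i = i' \<and> j = j'"
proof
  assume *: "i * m + j = i' * m + j'"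
  have "i = (i * m + j) div m" "i' = (i' * m + j') div m" using assms by auto
  with * have "i = i'" by simp
  with * show "i = i' \<and> j = j'" by simp
qed simp

lemma run_scale_prog:
  assumes "s ''input'' = inp" "s ''i'' 0 = int i" "i < m"
  shows "run scale_prog s ''w'' =
    (s ''w'')(int i := s ''w'' (int i) * (\<Prod>j\<in>{..<m} - {i}. fld 5 j))"
  unfolding scale_prog_def
proof (rule run_For[where P = "\<lambda>n s'. s' ''w'' =
    (s ''w'')(int i := s ''w'' (int i) * (\<Prod>j\<in>{..<n} - {i}. fld 5 j))"], goal_cases)
  case (4 k s')
  have [simp]: "s' ''input'' = inp" "s' ''i'' 0 = int i" "s' ''j'' 0 = int k"
    using 4 assms by auto
  show ?case
  proof (cases "k = i")
    case True
    then have "{..<Suc k} - {i} = {..<k} - {i}" by auto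
    then show ?thesis using 4(4) True by (simp add: store_apply)
  next
    case False
    then have "{..<Suc k} - {i} = insert k ({..<k} - {i})" by auto
    then have "(\<Prod>j\<in>{..<Suc k} - {i}. fld 5 j) = fld 5 k * (\<Prod>j\<in>{..<k} - {i}. fld 5 j)"
      by simp
    moreover have "run (Cond (beq (Var ''i'') (Var ''j'')) Nop
        (Put ''w'' (Var ''i'') (Mul (Cell ''w'' (Var ''i'')) (field 5 (Var ''j''))))) s' ''w'' =
      (s' ''w'')(int i := s' ''w'' (int i) * fld 5 k)"
      using False by (auto simp: store_apply aval_field)
    ultimately show ?thesis using 4(4) by (simp only: store_apply) (simp add: ac_simps)
  qed
qed (use assms in \<open>auto simp: store_apply aval_edge_number\<close>)

lemma run_weight_prog:
  assumes "s ''input'' = inp" "s ''a'' = (\<lambda>_. 0)"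
  shows "\<forall>k<m. run weight_prog s ''w'' (int k) = weight k \<and>
    run weight_prog s ''a'' (int k) = of_bool (0 < weight k) \<and> run weight_prog s ''g'' (int k) = int k"
proof -
  \<comment> \<open>Flags are only ever set, never cleared, in this loop; so the invariant must
    record that those not yet reached are zero.\<close>
  have "(\<forall>k<m. run weight_prog s ''w'' (int k) = weight k \<and>
      run weight_prog s ''a'' (int k) = of_bool (0 < weight k) \<and>
      run weight_prog s ''g'' (int k) = int k) \<and> (\<forall>k\<ge>m. run weight_prog s ''a'' (int k) = 0)"
    unfolding weight_prog_def
  proof (rule run_For[where P = "\<lambda>n s'. (\<forall>k<n. s' ''w'' (int k) = weight k \<and>
      s' ''a'' (int k) = of_bool (0 < weight k) \<and> s' ''g'' (int k) = int k) \<and>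
      (\<forall>k\<ge>n. s' ''a'' (int k) = 0)"], goal_cases)
    case (4 k s')
    let ?s = "store ''w'' (int k) (fld 4 k) s'"
    have s': "s' ''input'' = inp" "s' ''i'' 0 = int k"
      using 4 assms by (auto simp: written_simps)
    have w: "run scale_prog ?s ''w'' = (s' ''w'')(int k := weight k)"
      using run_scale_prog[of ?s k] s' 4(1) by (simp add: weight_def store_apply)
    have fr: "run scale_prog ?s y = s' y" if "y \<notin> {''j'', ''w''}" for y
      using run_frame[of y scale_prog ?s] that by (auto simp: written_simps store_apply)
    show ?case
      using 4(4) s' by (auto simp: store_apply aval_field w fr less_Suc_eq)
  qed (use assms in \<open>auto simp: store_apply aval_edge_number written_simps\<close>)
  then show ?thesis by blast
qed

text \<open>Pairs are treated in lexicographic order: entries before \<open>(i, j)\<close> are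
  final, the others still zero.\<close>

lemma run_conflict_prog3:
  assumes "s ''input'' = inp" "s ''i'' 0 = int i" "s ''j'' 0 = int j" "i < m" "j < m"
    and "\<forall>a<m. \<forall>b<m. s ''c'' (int (a * m + b)) = of_bool (conf a b \<and> (a < i \<or> a = i \<and> b < j))"
  shows "\<forall>a<m. \<forall>b<m. run conflict_prog3 s ''c'' (int (a * m + b)) =
    of_bool (conf a b \<and> (a < i \<or> a = i \<and> b < Suc j))"
proof -
  have "\<forall>a<m. \<forall>b<m. run conflict_prog3 s ''c'' (int (a * m + b)) =
    of_bool (conf a b \<and> (a < i \<or> a = i \<and> b < j) \<or> a = i \<and> b = j \<and> (\<exists>k<m. meet k i \<and> meet k j))"
    unfolding conflict_prog3_def
  proof (rule run_For[where P = "\<lambda>n s'. \<forall>a<m. \<forall>b<m. s' ''c'' (int (a * m + b)) =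
      of_bool (conf a b \<and> (a < i \<or> a = i \<and> b < j) \<or> a = i \<and> b = j \<and>
        (\<exists>k<n. meet k i \<and> meet k j))"], goal_cases)
    case (4 k s')
    have s': "s' ''input'' = inp" "s' ''i'' 0 = int i" "s' ''j'' 0 = int j" "s' ''k'' 0 = int k"
      using 4 assms by auto
    have eq: "int (a * m + b) = int (i * m + j) \<longleftrightarrow> a = i \<and> b = j" if "b < m" for a b
      using entry_eq_iff[OF that \<open>j < m\<close>] by (simp only: of_nat_eq_iff)
    let ?body = "Cond (BAnd (meets (Var ''k'') (Var ''i'')) (meets (Var ''k'') (Var ''j'')))
      (Put ''c'' (entry (Var ''i'') (Var ''j'')) (Const 1)) Nop"
    have body: "run ?body s' ''c'' = (if meet k i \<and> meet k j then (s' ''c'')(int (i * m + j) := 1)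
        else s' ''c'')"
      using s' bval_meets[of s' "Var ''k''" k "Var ''i''" i] bval_meets[of s' "Var ''k''" k "Var ''j''" j]
        aval_entry[of s' "Var ''i''" i "Var ''j''" j] by (simp add: store_apply)
    have Suc: "(\<exists>l<Suc k. Q l) \<longleftrightarrow> (\<exists>l<k. Q l) \<or> Q k" for Q by (auto simp: less_Suc_eq)
    show ?case
    proof (intro allI impI)
      fix a b assume ab: "a < m" "b < m"
      have "run ?body s' ''c'' (int (a * m + b)) =
          (if meet k i \<and> meet k j \<and> a = i \<and> b = j then 1 else s' ''c'' (int (a * m + b)))"
        unfolding body using eq[OF ab(2), of a] by (simp del: of_nat_add of_nat_mult)
      then show "store ''k'' 0 (int (Suc k)) (run ?body s') ''c'' (int (a * m + b)) =
          of_bool (conf a b \<and> (a < i \<or> a = i \<and> b < j) \<or> a = i \<and> b = j \<and>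
            (\<exists>l<Suc k. meet l i \<and> meet l j))"
        using 4(4)[rule_format, OF ab]
        by (auto simp del: run.simps of_nat_add of_nat_mult simp add: store_apply Suc)
    qed
  qed (use assms in \<open>auto simp: store_apply aval_edge_number\<close>)
  then show ?thesis by (auto simp: less_Suc_eq conf_def)
qed

lemma run_conflict_prog2:
  assumes "s ''input'' = inp" "s ''i'' 0 = int i" "i < m"
    and "\<forall>a<m. \<forall>b<m. s ''c'' (int (a * m + b)) = of_bool (conf a b \<and> a < i)"
  shows "\<forall>a<m. \<forall>b<m. run conflict_prog2 s ''c'' (int (a * m + b)) = of_bool (conf a b \<and> a < Suc i)"
proof -
  have "\<forall>a<m. \<forall>b<m. run conflict_prog2 s ''c'' (int (a * m + b)) =
    of_bool (conf a b \<and> (a < i \<or> a = i \<and> b < m))"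
    unfolding conflict_prog2_def
  proof (rule run_For[where P = "\<lambda>n s'. \<forall>a<m. \<forall>b<m. s' ''c'' (int (a * m + b)) =
      of_bool (conf a b \<and> (a < i \<or> a = i \<and> b < n))"], goal_cases)
    case (4 k s')
    have s': "s' ''input'' = inp" "s' ''i'' 0 = int i" "s' ''j'' 0 = int k"
      using 4 assms by (auto simp: written_simps)
    show ?case using run_conflict_prog3[OF s' \<open>i < m\<close> 4(1,4)] by (simp add: store_apply)
  qed (use assms in \<open>auto simp: store_apply aval_edge_number written_simps\<close>)
  then show ?thesis by (auto simp: less_Suc_eq)
qed

lemma run_conflict_prog:
  assumes "s ''input'' = inp" "s ''c'' = (\<lambda>_. 0)"
  shows "\<forall>a<m. \<forall>b<m. run conflict_prog s ''c'' (int (a * m + b)) = of_bool (conf a b)"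
proof -
  have "\<forall>a<m. \<forall>b<m. run conflict_prog s ''c'' (int (a * m + b)) = of_bool (conf a b \<and> a < m)"
    unfolding conflict_prog_def
  proof (rule run_For[where P = "\<lambda>n s'. \<forall>a<m. \<forall>b<m. s' ''c'' (int (a * m + b)) =
      of_bool (conf a b \<and> a < n)"], goal_cases)
    case (4 k s')
    have s': "s' ''input'' = inp" "s' ''i'' 0 = int k"
      using 4 assms by (auto simp: written_simps)
    show ?case using run_conflict_prog2[OF s' 4(1,4)] by (simp add: store_apply)
  qed (use assms in \<open>auto simp: store_apply aval_edge_number written_simps\<close>)
  then show ?thesis by auto
qed

definition holds_conflicts :: "state \<Rightarrow> bool" where
  "holds_conflicts s \<longleftrightarrow> s ''input'' = inp \<and>
    (\<forall>a<m. \<forall>b<m. s ''c'' (int (a * m + b)) = of_bool (conf a b))"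

definition stores :: "state \<Rightarrow> merging \<Rightarrow> bool" where
  "stores s = (\<lambda>(A, W, g). \<forall>k<m. s ''a'' (int k) = of_bool (k \<in> A) \<and> s ''w'' (int k) = W k \<and>
    s ''g'' (int k) = int (g k))"

lemma aval_conflict:
  assumes "holds_conflicts s" "aval a s = int i" "aval b s = int j" "i < m" "j < m"
  shows "aval (Cell ''c'' (entry a b)) s = of_bool (conf i j)"
  using assms aval_entry[of s a i b j] by (simp add: holds_conflicts_def)

lemma run_twins_prog:
  assumes "holds_conflicts s" "s ''i'' 0 = int i" "s ''j'' 0 = int j" "i < m" "j < m"
    and a: "\<forall>k<m. s ''a'' (int k) = of_bool (k \<in> A)"
  shows "run twins_prog s ''t'' 0 = of_bool (\<forall>k<m. k \<in> A - {i, j} \<longrightarrow> (conf i k \<longleftrightarrow> conf j k))"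
  unfolding twins_prog_def run.simps(3)
proof (rule run_For[where P = "\<lambda>n s'. s' ''t'' 0 =
    of_bool (\<forall>k<n. k \<in> A - {i, j} \<longrightarrow> (conf i k \<longleftrightarrow> conf j k))"], goal_cases)
  case (4 k s')
  have s': "holds_conflicts s'" "s' ''i'' 0 = int i" "s' ''j'' 0 = int j" "s' ''k'' 0 = int k"
    "s' ''a'' (int k) = of_bool (k \<in> A)"
    using 4 assms by (auto simp: holds_conflicts_def store_apply)
  have "aval (Cell ''c'' (entry (Var ''i'') (Var ''k''))) s' = of_bool (conf i k)"
    "aval (Cell ''c'' (entry (Var ''j'') (Var ''k''))) s' = of_bool (conf j k)"
    using aval_conflict[of s' "Var ''i''" i "Var ''k''" k] aval_conflict[of s' "Var ''j''" j "Var ''k''" k]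
      s' 4(1) assms(4,5) by simp_all
  then show ?case
    using 4(4) s' by (auto simp: store_apply less_Suc_eq)
qed (use assms in \<open>auto simp: store_apply aval_edge_number holds_conflicts_def\<close>)

lemma run_redirect_prog:
  assumes "s ''input'' = inp" "s ''i'' 0 = int i" "s ''j'' 0 = int j"
    and g: "\<forall>k<m. s ''g'' (int k) = int (g k)"
  shows "\<forall>k<m. run redirect_prog s ''g'' (int k) = int (if g k = j then i else g k)"
proof -
  have "\<forall>k<m. run redirect_prog s ''g'' (int k) = int (if k < m \<and> g k = j then i else g k)"
    unfolding redirect_prog_def
  proof (rule run_For[where P = "\<lambda>n s'. \<forall>k<m. s' ''g'' (int k) =
      int (if k < n \<and> g k = j then i else g k)"], goal_cases)
    case (4 k s')
    have s': "s' ''i'' 0 = int i" "s' ''j'' 0 = int j" "s' ''k'' 0 = int k"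
      using 4 assms by auto
    then show ?case using 4(1,4) by (auto simp: store_apply less_Suc_eq)
  qed (use assms in \<open>auto simp: store_apply aval_edge_number\<close>)
  then show ?thesis by simp
qed

lemma run_merge_prog:
  assumes hc: "holds_conflicts s" and s: "s ''i'' 0 = int i" "s ''j'' 0 = int j" "i < m" "j < m"
    and st: "stores s (A, W, g)" and A: "A \<subseteq> {..<m}"
  shows "stores (run merge_prog s) (merge conf i j (A, W, g))"
proof -
  let ?s = "run twins_prog s"
  have fr: "?s y = s y" if "y \<notin> {''t'', ''k''}" for y
    using that run_frame[of y twins_prog s] by (auto simp: written_simps)
  have a: "\<forall>k<m. s ''a'' (int k) = of_bool (k \<in> A)" using st by (simp add: stores_def)
  have t: "?s ''t'' 0 = of_bool (\<forall>k<m. k \<in> A - {i, j} \<longrightarrow> (conf i k \<longleftrightarrow> conf j k))"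
    by (rule run_twins_prog[OF hc s a])
  \<comment> \<open>The test ranges over all indices below \<open>m\<close>, which include
    \<open>A\<close>.\<close>
  have tw: "twins conf A i j \<longleftrightarrow> ?s ''t'' 0 = 1 \<and> i \<noteq> j \<and> i \<in> A \<and> j \<in> A"
    using A unfolding t twins_def by (auto simp: subset_eq)
  have s': "?s ''i'' 0 = int i" "?s ''j'' 0 = int j" "?s ''a'' = s ''a''" "?s ''w'' = s ''w''"
    "?s ''g'' = s ''g''" "?s ''input'' = inp"
    using fr s hc by (auto simp: holds_conflicts_def)
  have "holds_conflicts ?s" using hc fr by (simp add: holds_conflicts_def)
  then have c: "?s ''c'' (aval (entry (Var ''i'') (Var ''j'')) ?s) = of_bool (conf i j)"
    using aval_conflict[of ?s "Var ''i''" i "Var ''j''" j] s s' by simp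
  let ?u = "store ''a'' (int j) 0 (store ''w'' (int i) (W i + W j) ?s)"
  have red: "\<forall>k<m. run redirect_prog ?u ''g'' (int k) = int (if g k = j then i else g k)"
    using st s' by (intro run_redirect_prog) (auto simp: store_apply stores_def)
  have redfr: "run redirect_prog ?u y = ?u y" if "y \<notin> {''k'', ''g''}" for y
    using run_frame[of y redirect_prog ?u] that by (auto simp: written_simps)
  have st': "\<forall>k<m. s ''a'' (int k) = of_bool (k \<in> A) \<and> s ''w'' (int k) = W k \<and>
    s ''g'' (int k) = int (g k)"
    using st by (simp add: stores_def)
  show ?thesis
  proof (cases "twins conf A i j")
    case False
    then show ?thesis using tw s' st' s(3,4) by (auto simp: store_apply merge_prog_def stores_def)
  next
    case True
    note tw' = True[unfolded tw]
    show ?thesis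
    proof (cases "conf i j")
      case True
      then show ?thesis using \<open>twins conf A i j\<close> tw' s' st' s(3,4) c
        by (auto simp: store_apply merge_prog_def stores_def)
    next
      case False
      then have "run merge_prog s = run redirect_prog ?u"
        using tw' s' st' s(3,4) c
        by (auto simp: merge_prog_def store_apply[of _ _ _ _ "''j''"])
      then show ?thesis using \<open>twins conf A i j\<close> False red redfr st' s' s(3,4)
        by (auto simp: store_apply stores_def)
    qed
  qed
qed

text \<open>The invariant of a sweep: \<open>A0\<close> are the survivors at its start,
  \<open>D\<close> the pairs tested so far.\<close>

definition holds_merging :: "nat set \<Rightarrow> (nat \<times> nat) set \<Rightarrow> state \<Rightarrow> bool" where
  "holds_merging A0 D s \<longleftrightarrow> holds_conflicts s \<and>
    (\<exists>\<sigma>. stores s \<sigma> \<and> represents conf m weight \<sigma> \<and> progress conf A0 D (fst \<sigma>))"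

lemma holds_conflicts_store:
  assumes "x \<notin> {''input'', ''c''}"
  shows "holds_conflicts (store x i v s) = holds_conflicts s"
proof -
  have "store x i v s y = s y" if "y \<in> {''input'', ''c''}" for y
    using assms that by (auto simp: store_apply)
  then show ?thesis by (simp add: holds_conflicts_def)
qed

lemma stores_store:
  assumes "x \<notin> {''a'', ''w'', ''g''}"
  shows "stores (store x i v s) \<sigma> = stores s \<sigma>"
proof -
  have "store x i v s y = s y" if "y \<in> {''a'', ''w'', ''g''}" for y
    using assms that by (auto simp: store_apply)
  then show ?thesis by (simp add: stores_def)
qed

lemma holds_merging_store:
  "x \<notin> {''input'', ''c'', ''a'', ''w'', ''g''} \<Longrightarrow>
    holds_merging A0 D (store x i v s) = holds_merging A0 D s"
  by (simp add: holds_merging_def holds_conflicts_store stores_store)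

lemma holds_merging_merge_prog:
  assumes "holds_merging A0 D s" "s ''i'' 0 = int i" "s ''j'' 0 = int j" "i < m" "j < m"
  shows "holds_merging A0 (insert (i, j) D) (run merge_prog s)"
proof -
  obtain A W g where \<sigma>: "holds_conflicts s" "stores s (A, W, g)" "represents conf m weight (A, W, g)"
    "progress conf A0 D A"
    using assms(1) by (auto simp: holds_merging_def)
  have A: "A \<subseteq> {..<m}" using \<sigma>(3) by (simp add: represents_def)
  then have "finite A" by (rule finite_subset) simp
  have "holds_conflicts (run merge_prog s)"
    using \<sigma>(1) run_frame[of _ merge_prog s] by (simp add: holds_conflicts_def written_simps)
  moreover have "progress conf A0 (insert (i, j) D) (fst (merge conf i j (A, W, g)))"
    using \<sigma>(4) \<open>finite A\<close> by (intro progress_merge) auto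
  ultimately show ?thesis
    using run_merge_prog[OF \<sigma>(1) assms(2-5) \<sigma>(2) A] represents_merge[OF \<sigma>(3) symp_conf]
    unfolding holds_merging_def by blast
qed

lemma holds_merging_sweep_prog:
  assumes "holds_merging A0 {} s"
  shows "holds_merging A0 ({..<m} \<times> {..<m}) (run sweep_prog s)"
  unfolding sweep_prog_def
proof (rule run_For[where P = "\<lambda>n s'. holds_merging A0 ({..<n} \<times> {..<m}) s'"], goal_cases)
  case (4 i s1)
  have "holds_merging A0 ({..<i} \<times> {..<m} \<union> {i} \<times> {..<m}) (run sweep_prog1 s1)"
    unfolding sweep_prog1_def
  proof (rule run_For[where P = "\<lambda>n s'. holds_merging A0 ({..<i} \<times> {..<m} \<union> {i} \<times> {..<n}) s'"],
      goal_cases)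
    case (4 j s2)
    have s2: "s2 ''i'' 0 = int i" using 4 \<open>s1 ''i'' 0 = int i\<close> by (simp add: written_simps)
    have "insert (i, j) ({..<i} \<times> {..<m} \<union> {i} \<times> {..<j}) = {..<i} \<times> {..<m} \<union> {i} \<times> {..<Suc j}"
      by auto
    then show ?case using holds_merging_merge_prog[OF 4(4) s2 4(2) \<open>i < m\<close> 4(1)]
      by (simp add: holds_merging_store)
  next
    case 2
    then show ?case using 4 aval_edge_number by (simp add: holds_merging_def holds_conflicts_def)
  qed (use 4 in \<open>auto simp: written_simps holds_merging_store\<close>)
  moreover have "{..<i} \<times> {..<m} \<union> {i} \<times> {..<m} = {..<Suc i} \<times> {..<m}" by auto
  ultimately show ?case by (simp add: holds_merging_store)
next
  case 2
  then show ?case using assms aval_edge_number by (simp add: holds_merging_def holds_conflicts_def)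
qed (use assms in \<open>auto simp: written_simps holds_merging_store\<close>)

text \<open>After \<open>n\<close> sweeps at most one index survives or at most \<open>m - n\<close>
  do: while at least two survive, twins exist, and by \<open>progress\<close> a sweep over all pairs
  cannot leave the set unchanged. For \<open>n = m\<close> both alternatives give at most one
  survivor.\<close>

lemma run_rounds_prog:
  assumes ex_twins: "\<And>A. A \<subseteq> {..<m} \<Longrightarrow> card A \<ge> 2 \<Longrightarrow> \<exists>i j. twins conf A i j"
    and "holds_conflicts s" "stores s \<sigma>" "represents conf m weight \<sigma>"
  shows "\<exists>\<sigma>. stores (run rounds_prog s) \<sigma> \<and> represents conf m weight \<sigma> \<and> card (fst \<sigma>) \<le> 1"
proof -
  let ?P = "\<lambda>n s'. holds_conflicts s' \<and> (\<exists>\<sigma>. stores s' \<sigma> \<and> represents conf m weight \<sigma> \<and>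
      (card (fst \<sigma>) \<le> 1 \<or> card (fst \<sigma>) + n \<le> m))"
  have "?P m (run rounds_prog s)"
    unfolding rounds_prog_def
  proof (rule run_For[where P = ?P], goal_cases)
    case 2
    then show ?case using assms aval_edge_number by (simp add: holds_conflicts_def)
  next
    case 3
    have "fst \<sigma> \<subseteq> {..<m}" using assms(4) by (auto simp: represents_def split: prod.splits)
    then have "card (fst \<sigma>) \<le> m" using card_mono[of "{..<m}" "fst \<sigma>"] by simp
    then show ?case using assms
      by (intro conjI exI[of _ \<sigma>]) (simp_all add: holds_conflicts_store stores_store)
  next
    case (4 k s')
    then obtain \<sigma> where \<sigma>: "holds_conflicts s'" "stores s' \<sigma>" "represents conf m weight \<sigma>"
      "card (fst \<sigma>) \<le> 1 \<or> card (fst \<sigma>) + k \<le> m" by blast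
    have "progress conf (fst \<sigma>) {} (fst \<sigma>)" by (simp add: progress_def)
    with \<sigma> have "holds_merging (fst \<sigma>) {} s'" unfolding holds_merging_def by blast
    from holds_merging_sweep_prog[OF this] obtain \<tau> where \<tau>: "holds_conflicts (run sweep_prog s')"
      "stores (run sweep_prog s') \<tau>" "represents conf m weight \<tau>"
      "progress conf (fst \<sigma>) ({..<m} \<times> {..<m}) (fst \<tau>)"
      unfolding holds_merging_def by blast
    have sub: "fst \<sigma> \<subseteq> {..<m}" using \<sigma>(3) by (auto simp: represents_def split: prod.splits)
    have "card (fst \<tau>) < card (fst \<sigma>) \<or> card (fst \<tau>) \<le> 1"
    proof (rule disjCI)
      assume "\<not> card (fst \<tau>) \<le> 1"
      show "card (fst \<tau>) < card (fst \<sigma>)"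
      proof (rule ccontr)
        assume "\<not> card (fst \<tau>) < card (fst \<sigma>)"
        with \<tau>(4) have *: "fst \<tau> = fst \<sigma>" "\<forall>i<m. \<forall>j<m. \<not> twins conf (fst \<sigma>) i j"
          by (auto simp: progress_def)
        with \<open>\<not> card (fst \<tau>) \<le> 1\<close> obtain i j where "twins conf (fst \<sigma>) i j"
          using ex_twins[OF sub] by fastforce
        moreover from this sub have "i < m" "j < m" by (auto simp: twins_def)
        ultimately show False using *(2) by blast
      qed
    qed
    with \<sigma>(4) have "card (fst \<tau>) \<le> 1 \<or> card (fst \<tau>) + Suc k \<le> m" by linarith
    with \<tau> show ?case
      by (intro conjI exI[of _ \<tau>]) (simp_all add: holds_conflicts_store stores_store)
  qed (simp add: written_simps)
  then show ?thesis by fastforce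
qed

lemma run_output_prog:
  assumes "s ''input'' = inp" "s ''q'' 0 = 0" and st: "stores s (A, W, g)" and g: "\<forall>k<m. g k < m"
  defines "sel \<equiv> filter (\<lambda>k. g k \<in> A) [0..<m]"
  shows "run output_prog s ''output'' 0 = int (length sel)"
    "\<forall>t<length sel. run output_prog s ''output'' (1 + 2 * int t) = fld 2 (sel ! t) \<and>
      run output_prog s ''output'' (2 + 2 * int t) = fld 3 (sel ! t)"
proof -
  define body where "body = Cond (beq (Cell ''a'' (Cell ''g'' (Var ''i''))) (Const 1))
      (Put ''output'' (Add (Const 1) (Mul (Const 2) (Var ''q''))) (field 2 (Var ''i'')) ;;
       Put ''output'' (Add (Const 2) (Mul (Const 2) (Var ''q''))) (field 3 (Var ''i'')) ;;
       Put ''q'' (Const 0) (Add (Var ''q'') (Const 1)))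
      Nop"
  let ?P = "\<lambda>n s'. s' ''q'' 0 = int (length (filter (\<lambda>k. g k \<in> A) [0..<n])) \<and>
    (\<forall>t<length (filter (\<lambda>k. g k \<in> A) [0..<n]).
      s' ''output'' (1 + 2 * int t) = fld 2 (filter (\<lambda>k. g k \<in> A) [0..<n] ! t) \<and>
      s' ''output'' (2 + 2 * int t) = fld 3 (filter (\<lambda>k. g k \<in> A) [0..<n] ! t))"
  have "?P m (run (For ''i'' edge_number body) s)"
  proof (rule run_For[where P = ?P], goal_cases)
    case (4 k s')
    let ?l = "filter (\<lambda>k. g k \<in> A) [0..<k]"
    have s': "s' ''input'' = inp" "s' ''i'' 0 = int k" "s' ''g'' (int k) = int (g k)"
      "s' ''a'' (int (g k)) = of_bool (g k \<in> A)"
      using 4 assms by (auto simp: body_def stores_def)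
    show ?case
    proof (cases "g k \<in> A")
      case False
      then show ?thesis using 4(4) s' by (simp add: body_def store_apply)
    next
      case True
      let ?q = "int (length ?l)"
      have "run body s' = store ''q'' 0 (?q + 1) (store ''output'' (2 + 2 * ?q) (fld 3 k)
          (store ''output'' (1 + 2 * ?q) (fld 2 k) s'))"
        using True 4(4) s' by (simp add: body_def aval_field store_apply)
      \<comment> \<open>First ends go to odd cells and second ends to even ones, so the two writes
        never collide.\<close>
      moreover have "1 + 2 * int t \<noteq> 2 + 2 * int t'" "2 + 2 * int t \<noteq> 1 + 2 * int t'" for t t'
        by presburger+
      ultimately show ?thesis
        using 4(4) True by (auto simp: store_apply less_Suc_eq nth_append)
    qed
  qed (use assms in \<open>auto simp: store_apply aval_edge_number body_def\<close>)
  then show "run output_prog s ''output'' 0 = int (length sel)"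
    "\<forall>t<length sel. run output_prog s ''output'' (1 + 2 * int t) = fld 2 (sel ! t) \<and>
      run output_prog s ''output'' (2 + 2 * int t) = fld 3 (sel ! t)"
    by (auto simp: store_apply output_prog_def sel_def simp flip: body_def)
qed

end

lemma (in edge_data) run_matching_prog:
  assumes "s ''input'' = inp" and zero: "\<And>x. x \<noteq> ''input'' \<Longrightarrow> s x = (\<lambda>_. 0)"
    and ex_twins: "\<And>A. A \<subseteq> {..<m} \<Longrightarrow> card A \<ge> 2 \<Longrightarrow> \<exists>i j. twins conf A i j"
  obtains K where "K \<subseteq> {..<m}" "indep conf K"
    "\<And>J. J \<subseteq> {..<m} \<Longrightarrow> indep conf J \<Longrightarrow> sum weight J \<le> sum weight K"
    "run matching_prog s ''output'' 0 = int (length (filter (\<lambda>k. k \<in> K) [0..<m]))"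
    "\<And>t. t < length (filter (\<lambda>k. k \<in> K) [0..<m]) \<Longrightarrow>
      run matching_prog s ''output'' (1 + 2 * int t) = fld 2 (filter (\<lambda>k. k \<in> K) [0..<m] ! t) \<and>
      run matching_prog s ''output'' (2 + 2 * int t) = fld 3 (filter (\<lambda>k. k \<in> K) [0..<m] ! t)"
proof -
  define s1 where "s1 = run weight_prog s"
  define s2 where "s2 = run conflict_prog s1"
  define s3 where "s3 = run rounds_prog s2"
  have fr1: "s1 y = s y" if "y \<notin> {''i'', ''w'', ''j'', ''a'', ''g''}" for y
    using that run_frame[of y weight_prog s] by (simp add: s1_def written_simps)
  have fr2: "s2 y = s1 y" if "y \<notin> {''i'', ''j'', ''k'', ''c''}" for y
    using that run_frame[of y conflict_prog s1] by (simp add: s2_def written_simps)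
  have fr3: "s3 y = s2 y" if "y \<notin> {''r'', ''i'', ''j'', ''t'', ''k'', ''a'', ''w'', ''g''}" for y
    using that run_frame[of y rounds_prog s2] by (simp add: s3_def written_simps)
  have inp: "s1 ''input'' = inp" "s2 ''input'' = inp" "s3 ''input'' = inp"
    using fr1 fr2 fr3 assms(1) by auto
  have "s ''a'' = (\<lambda>_. 0)" by (rule zero) simp
  then have "stores s2 ({k. k < m \<and> 0 < weight k}, weight, \<lambda>k. k)"
    using run_weight_prog[of s] assms(1) fr2 by (simp add: stores_def s1_def)
  moreover have "s1 ''c'' = (\<lambda>_. 0)" using fr1 zero by simp
  then have "holds_conflicts s2"
    using run_conflict_prog[of s1] inp(1,2) by (simp add: holds_conflicts_def s2_def)
  ultimately obtain A W g where st: "stores s3 (A, W, g)" and rep: "represents conf m weight (A, W, g)"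
    and "card A \<le> 1"
    using run_rounds_prog[OF ex_twins, of s2 "({k. k < m \<and> 0 < weight k}, weight, \<lambda>k. k)"]
      represents_positive[of conf m weight] by (auto simp: s3_def)
  define K where "K = {k. k < m \<and> g k \<in> A}"
  have g: "\<forall>k<m. g k < m" using rep by (simp add: represents_def)
  have sel: "filter (\<lambda>k. g k \<in> A) [0..<m] = filter (\<lambda>k. k \<in> K) [0..<m]"
    by (rule filter_cong) (auto simp: K_def)
  have q: "s3 ''q'' 0 = 0" using fr1 fr2 fr3 zero by simp
  have run: "run matching_prog s = run output_prog s3"
    by (simp add: matching_prog_def s1_def s2_def s3_def)
  show ?thesis
  proof (rule that)
    show "K \<subseteq> {..<m}" by (auto simp: K_def)
    show "indep conf K"
      using represents_optimal(1)[OF rep \<open>card A \<le> 1\<close>, of "{}"] by (simp add: K_def indep_def)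
    show "sum weight J \<le> sum weight K" if "J \<subseteq> {..<m}" "indep conf J" for J
      using represents_optimal(2)[OF rep \<open>card A \<le> 1\<close> that] by (simp add: K_def)
  qed (use run_output_prog[of s3 A W g] inp(3) q st g in \<open>simp_all add: run sel\<close>)
qed

section \<open>Decoding the input and correctness of the output\<close>

lemma nth_concat_blocks:
  assumes "\<And>x. x \<in> set xs \<Longrightarrow> length (f x) = c" "k < length xs" "r < c"
  shows "concat (map f xs) ! (c * k + r) = f (xs ! k) ! r"
  using assms
proof (induction xs arbitrary: k)
  case (Cons x xs)
  then show ?case
  proof (cases k)
    case (Suc k')
    have "length (f x) = c" using Cons.prems by simp
    then show ?thesis using Cons Suc by (simp add: nth_append)
  qed (simp add: nth_append)
qed simp

lemma length_concat_blocks: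
  assumes "\<And>x. x \<in> set xs \<Longrightarrow> length (f x) = c"
  shows "length (concat (map f xs)) = c * length xs"
  using assms by (induction xs) auto

text \<open>Via the numbering \<open>e\<close> of the edges, independent sets of \<open>conf\<close>
  become acyclic matchings by \<open>acyclic_matchingI\<close>, and all acyclic matchings arise in
  this way by \<open>acyclic_matchingD\<close>; the integer weights are the rational ones times a
  common positive factor.\<close>

lemma matching_prog_correct:
  fixes G :: "nat ugraph" and w :: "nat set \<Rightarrow> rat"
  assumes G: "simple_graph G" "P4_free G" and enc: "encodes_weighted_graph G w xs"
  shows "aval edge_number (initial_state xs) \<le> int (encoding_length xs)"
    "\<exists>M ys. has_output (run matching_prog (initial_state xs)) ys \<and> encodes_edge_set M ys \<and>
      max_weight_acyclic_matching G w M"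
proof -
  let ?block = "\<lambda>(u, v). [int u, int v, fst (quotient_of (w {u, v})), snd (quotient_of (w {u, v}))]"
  obtain vs es where es: "lists_edges (edges G) es" and
    xs: "xs = int (length vs) # map int vs @ int (length es) # concat (map ?block es)"
    using enc unfolding encodes_weighted_graph_def by blast
  define n where "n = length vs"
  define m where "m = length es"
  define e where "e = (\<lambda>k. {fst (es ! k), snd (es ! k)})"
  define inp where "inp = initial_state xs ''input''"
  have len_xs: "length xs = n + 2 + 4 * m"
    using length_concat_blocks[of es ?block 4] by (auto simp: xs n_def m_def)
  have inp: "inp (int i) = xs ! i" if "i < length xs" for i
    using that by (simp add: inp_def initial_state_def)
  have inp0: "inp 0 = int n" using inp[of 0] by (simp add: xs n_def)
  have inpm: "inp (1 + inp 0) = int m"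
    using inp[of "Suc n"] len_xs inp0 by (simp add: xs n_def m_def nth_append)
  interpret edge_data inp m by unfold_locales (rule inpm)
  have "length es \<le> encoding_length xs"
    using length_le_encoding_length[of xs] len_xs by (simp add: m_def)
  then show "aval edge_number (initial_state xs) \<le> int (encoding_length xs)"
    using aval_edge_number[of "initial_state xs"] by (simp add: inp_def m_def)
  \<comment> \<open>The blocks of four cells start behind two counts and \<open>n\<close> names, at
    cell \<open>n + 2\<close>; hence the offsets 2 to 5 of \<open>fld\<close>.\<close>
  have block: "inp (int n + 2 + int r + 4 * int k) = ?block (es ! k) ! r" if "k < m" "r < 4" for k r
  proof -
    have "int n + 2 + int r + 4 * int k = int (n + 2 + (4 * k + r))" by simp
    also have "inp \<dots> = xs ! (n + 2 + (4 * k + r))" by (rule inp) (use that len_xs in simp)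
    also have "\<dots> = concat (map ?block es) ! (4 * k + r)"
      by (simp add: xs n_def nth_append)
    also have "\<dots> = ?block (es ! k) ! r"
      using that by (intro nth_concat_blocks) (auto simp: m_def)
    finally show ?thesis .
  qed
  have fld: "fld 2 k = int (fst (es ! k))" "fld 3 k = int (snd (es ! k))"
    "fld 4 k = fst (quotient_of (w (e k)))" "fld 5 k = snd (quotient_of (w (e k)))" if "k < m" for k
    using block[OF that, of 0] block[OF that, of 1] block[OF that, of 2] block[OF that, of 3]
    by (simp_all add: fld_def inp0 e_def ac_simps split: prod.splits)
  have map_e: "map (\<lambda>(u, v). {u, v}) es = map e [0..<m]"
    by (rule nth_equalityI) (auto simp: m_def e_def split: prod.splits)
  have inj: "inj_on e {..<m}" and im: "e ` {..<m} = edges G"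
    using es unfolding lists_edges_def map_e by (auto simp: distinct_map atLeast0LessThan)
  have meet: "meet i j \<longleftrightarrow> e i \<inter> e j \<noteq> {}" if "i < m" "j < m" for i j
    using fld[OF that(1)] fld[OF that(2)] by (auto simp: meet_def e_def)
  \<comment> \<open>\<open>conf\<close> and the conflicts of \<open>G\<close> are only known to
    agree below \<open>m\<close>, where \<open>fld\<close> reads the encoded edges; \<open>R\<close>
    is the relation of \<open>conflict_split\<close> on all indices.\<close>
  define R where "R i j \<longleftrightarrow> (\<exists>k\<in>{..<m}. e k \<inter> e i \<noteq> {} \<and> e k \<inter> e j \<noteq> {})" for i j
  have conf: "conf i j \<longleftrightarrow> R i j" if "i < m" "j < m" for i j
    unfolding conf_def R_def using meet[OF _ that(1)] meet[OF _ that(2)] by (meson lessThan_iff)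
  have twins: "\<exists>i j. twins conf A i j" if A: "A \<subseteq> {..<m}" "card A \<ge> 2" for A
  proof -
    have "finite A" using A(1) by (rule finite_subset) simp
    have "\<exists>i j. twins R A i j"
    proof (rule ex_twins[OF \<open>finite A\<close> A(2)])
      show "symp R" by (auto simp: symp_def R_def)
      show "\<exists>B C. split_by R S B C" if S: "S \<subseteq> A" "card S \<ge> 2" for S
        unfolding R_def
        by (rule conflict_split[OF G inj im]) (use S A \<open>finite A\<close> finite_subset in auto)
    qed
    then obtain i j where ij: "twins R A i j" by blast
    have "conf x y \<longleftrightarrow> R x y" if "x \<in> A" "y \<in> A" for x y
      using conf[of x y] that A(1) by auto
    with ij have "twins conf A i j" by (auto simp: twins_def)
    then show ?thesis by blast
  qed
  \<comment> \<open>The common factor: \<open>weight k\<close> lacks the denominator of edge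
    \<open>k\<close> itself, which cancels against that of its rational weight. Since
    \<open>D\<close> is positive, comparisons of sums carry over.\<close>
  define D where "D = (\<Prod>j<m. fld 5 j)"
  have denom: "fld 5 j > 0" if "j < m" for j using fld(4)[OF that] quotient_of_denom_pos' by simp
  have "D > 0" using denom unfolding D_def by (intro prod_pos) auto
  have weight: "of_int (weight k) = w (e k) * of_int D" if "k < m" for k
  proof -
    have "w (e k) = of_int (fld 4 k) / of_int (fld 5 k)"
      unfolding fld[OF that] by (rule quotient_of_div) simp
    moreover have "D = fld 5 k * (\<Prod>j\<in>{..<m} - {k}. fld 5 j)"
      unfolding D_def by (rule prod.remove) (use that in auto)
    ultimately show ?thesis using denom[OF that] by (simp add: weight_def)
  qed
  have sum_weight: "of_int (sum weight J) = (\<Sum>f\<in>e ` J. w f) * of_int D" if "J \<subseteq> {..<m}" for J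
  proof -
    have "of_int (sum weight J) = (\<Sum>k\<in>J. w (e k) * of_int D)"
      unfolding of_int_sum by (rule sum.cong) (use that weight in auto)
    also have "\<dots> = (\<Sum>f\<in>e ` J. w f) * of_int D"
      using inj_on_subset[OF inj that] by (simp add: sum.reindex sum_distrib_right)
    finally show ?thesis .
  qed
  let ?s = "initial_state xs"
  obtain K where K: "K \<subseteq> {..<m}" "indep conf K"
    "\<And>J. J \<subseteq> {..<m} \<Longrightarrow> indep conf J \<Longrightarrow> sum weight J \<le> sum weight K"
    "run matching_prog ?s ''output'' 0 = int (length (filter (\<lambda>k. k \<in> K) [0..<m]))"
    "\<And>t. t < length (filter (\<lambda>k. k \<in> K) [0..<m]) \<Longrightarrow>
      run matching_prog ?s ''output'' (1 + 2 * int t) = fld 2 (filter (\<lambda>k. k \<in> K) [0..<m] ! t) \<and>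
      run matching_prog ?s ''output'' (2 + 2 * int t) = fld 3 (filter (\<lambda>k. k \<in> K) [0..<m] ! t)"
  proof (rule run_matching_prog[of ?s])
    show "?s ''input'' = inp" by (simp add: inp_def)
    show "?s x = (\<lambda>_. 0)" if "x \<noteq> ''input''" for x using that by (simp add: initial_state_def)
  qed (use twins in auto)
  define sel where "sel = filter (\<lambda>k. k \<in> K) [0..<m]"
  have sel: "set sel = K" "distinct sel" using K(1) by (auto simp: sel_def)
  define es' where "es' = map (\<lambda>k. es ! k) sel"
  define ys where "ys = int (length es') # concat (map (\<lambda>(u, v). [int u, int v]) es')"
  have "map (\<lambda>(u, v). {u, v}) es' = map e sel"
    by (simp add: es'_def e_def split: prod.splits)
  then have "lists_edges (e ` K) es'"
    using sel inj_on_subset[OF inj K(1)] by (simp add: lists_edges_def distinct_map)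
  then have enc: "encodes_edge_set (e ` K) ys"
    unfolding encodes_edge_set_def ys_def by blast
  have "has_output (run matching_prog ?s) ys"
    unfolding has_output_def
  proof (intro allI impI)
    fix i assume i: "i < length ys"
    show "run matching_prog ?s ''output'' (int i) = ys ! i"
    proof (cases i)
      case 0
      then show ?thesis using K(4) by (simp add: ys_def es'_def sel_def)
    next
      case (Suc t)
      have "length (concat (map (\<lambda>(u, v). [int u, int v]) es')) = 2 * length es'"
        by (rule length_concat_blocks) auto
      with i Suc have t: "t < 2 * length sel" by (simp add: ys_def es'_def)
      define k where "k = t div 2"
      have k: "k < length sel" using t by (simp add: k_def)
      have "sel ! k \<in> K" using sel(1) k nth_mem by blast
      then have km: "sel ! k < m" using K(1) by auto
      have t_eq: "t = 2 * k + t mod 2" by (simp add: k_def)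
      have ys_i: "ys ! i = (\<lambda>(u, v). [int u, int v]) (es ! (sel ! k)) ! (t mod 2)"
      proof -
        have "ys ! i = concat (map (\<lambda>(u, v). [int u, int v]) es') ! (2 * k + t mod 2)"
          using Suc t_eq by (simp add: ys_def)
        also have "\<dots> = (\<lambda>(u, v). [int u, int v]) (es' ! k) ! (t mod 2)"
          by (rule nth_concat_blocks) (use k in \<open>auto simp: es'_def\<close>)
        finally show ?thesis using k by (simp add: es'_def)
      qed
      have out: "run matching_prog ?s ''output'' (1 + 2 * int k) = int (fst (es ! (sel ! k)))"
        "run matching_prog ?s ''output'' (2 + 2 * int k) = int (snd (es ! (sel ! k)))"
        using K(5)[folded sel_def, OF k] fld[OF km] by auto
      show ?thesis
      proof (cases "t mod 2 = 0")
        case True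
        then have "int i = 1 + 2 * int k" using Suc t_eq by simp
        with out(1) ys_i True show ?thesis by (simp split: prod.splits)
      next
        case False
        then have "t mod 2 = 1" by simp
        moreover from this have "int i = 2 + 2 * int k" using Suc t_eq by simp
        ultimately show ?thesis using out(2) ys_i by (simp split: prod.splits)
      qed
    qed
  qed
  moreover have "max_weight_acyclic_matching G w (e ` K)"
    unfolding max_weight_acyclic_matching_def
  proof (intro conjI allI impI)
    show "acyclic_matching G (e ` K)"
    proof (rule acyclic_matchingI[OF G(1)])
      show "e ` K \<subseteq> edges G" using K(1) im by auto
      fix f f' k
      assume f: "f \<in> e ` K" "f' \<in> e ` K" "k \<in> edges G" "k \<inter> f \<noteq> {}" "k \<inter> f' \<noteq> {}"
      from f(1) obtain i where i: "i \<in> K" "f = e i" by (elim imageE)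
      from f(2) obtain j where j: "j \<in> K" "f' = e j" by (elim imageE)
      from f(3) obtain l where "l < m" "k = e l" unfolding im[symmetric] by (elim imageE) simp
      note l = i j this
      have "R i j" unfolding R_def by (rule bexI[of _ l]) (use l f in auto)
      then have "conf i j" using conf[of i j] l K(1) by auto
      then show "f = f'" using indepD[OF K(2) l(1,3)] l by auto
    qed
    fix M' assume M': "acyclic_matching G M'"
    \<comment> \<open>The given matching is the image of \<open>J\<close> under \<open>e\<close>, so
      the optimality of \<open>K\<close> applies once \<open>J\<close> is shown independent.\<close>
    define J where "J = {i. i < m \<and> e i \<in> M'}"
    have "M' \<subseteq> edges G" using M' by (simp add: acyclic_matching_def matching_def)
    then have "M' \<subseteq> e ` {..<m}" using im by simp
    then have eJ: "e ` J = M'" by (force simp: J_def)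
    have J: "J \<subseteq> {..<m}" by (auto simp: J_def)
    have "indep conf J"
      unfolding indep_def
    proof (intro ballI impI notI)
      fix i j assume ij: "i \<in> J" "j \<in> J" "i \<noteq> j" "conf i j"
      then obtain k where k: "k < m" "e k \<inter> e i \<noteq> {}" "e k \<inter> e j \<noteq> {}"
        using conf[of i j] by (auto simp: J_def R_def)
      then have "e k \<in> edges G" using im by auto
      then have "e i = e j"
        using acyclic_matchingD[OF G M' _ _ _ k(2,3)] ij by (auto simp: J_def)
      then show False using inj ij by (auto simp: J_def inj_on_def)
    qed
    then have "sum weight J \<le> sum weight K" using K(3) J by blast
    then have "(of_int (sum weight J) :: rat) \<le> of_int (sum weight K)" by (simp only: of_int_le_iff)
    then show "sum w M' \<le> sum w (e ` K)"
      using sum_weight[OF J] sum_weight[OF K(1)] eJ \<open>D > 0\<close> by simp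
  qed
  ultimately show "\<exists>M ys. has_output (run matching_prog ?s) ys \<and> encodes_edge_set M ys \<and>
      max_weight_acyclic_matching G w M"
    using enc by blast
qed

theorem theorem2:
  shows "\<exists>(c :: com) (p :: nat poly).
    \<forall>(G :: nat ugraph) (w :: nat set \<Rightarrow> rat) (xs :: int list).
      simple_graph G \<longrightarrow> P4_free G \<longrightarrow> encodes_weighted_graph G w xs \<longrightarrow>
      (\<exists>t s M ys. exec c (initial_state xs) t s \<and>
        t \<le> poly p (encoding_length xs) \<and>
        has_output s ys \<and> encodes_edge_set M ys \<and>
        max_weight_acyclic_matching G w M)"
proof -
  obtain q where q: "\<forall>xs. loops_bounded (encoding_length xs) matching_prog (initial_state xs) \<longrightarrow>
    (\<exists>t. exec (compile matching_prog) (initial_state xs) t (run matching_prog (initial_state xs)) \<and>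
      t \<le> poly q (encoding_length xs))"
    using compile_polynomial[OF admissible_matching_prog] by blast
  show ?thesis
  proof (intro exI[of _ "compile matching_prog"] exI[of _ q] allI impI)
    fix G :: "nat ugraph" and w :: "nat set \<Rightarrow> rat" and xs :: "int list"
    assume *: "simple_graph G" "P4_free G" "encodes_weighted_graph G w xs"
    note correct = matching_prog_correct[OF *]
    from q loops_bounded_matching_prog[OF correct(1)] correct(2)
    show "\<exists>t s M ys. exec (compile matching_prog) (initial_state xs) t s \<and>
        t \<le> poly q (encoding_length xs) \<and> has_output s ys \<and> encodes_edge_set M ys \<and>
        max_weight_acyclic_matching G w M"
      by blast
  qed
qed

end
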